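(* Let $\Omega_q\subseteq\mathbb{H}$ be an axially symmetric connected open set with $\Omega_q\cap\mathbb{R}=\emptyset$, and let $T,\widetilde{T}\in B_1^{s}(\Omega_q)$. Then $T$ and $\widetilde{T}$ are quaternion unitarily equivalent if and only if $T_{\mathbb{C}}$ and $\widetilde{T}_{\mathbb{C}}$ are unitarily equivalent as bounded (complex) linear operators acting on $(\mathcal{H}_q)_{\mathbb{C}}$.
   Context: $\mathbb{H}$ denotes the quaternions with units $\boldsymbol{i},\boldsymbol{j},\boldsymbol{k}$; $\mathbb{C}$ is identified with $\{a+b\boldsymbol{i}\}\subset\mathbb{H}$. For $p,q\in\mathbb{H}$, $p\sim q$ means $|p|=|q|$ and $\mathrm{Re}(p)=\mathrm{Re}(q)$; a subset of $\mathbb{H}$ is axially symmetric if it contains, with each $x$, all $y\sim x$. $\mathcal{H}_q$ is a separable quaternionic Hilbert space (right $\mathbb{H}$-vector space, inner product $\langle\cdot,\cdot\rangle_{\mathbb{H}}$ with $\langle x,y\rangle_{\mathbb H}=\overline{\langle y,x\rangle_{\mathbb H}}$ and $\langle xp+yq,z\rangle_{\mathbb H}=\langle x,z\rangle_{\mathbb H}p+\langle y,z\rangle_{\mathbb H}q$). $L_r(\mathcal{H}_q)$ is the set of bounded right $\mathbb{H}$-linear operators. $\bigvee_{\mathbb{H}}$ denotes closed right $\mathbb{H}$-linear span. $\sigma_s(T)=\{s\in\mathbb{H}: T^2-2\mathrm{Re}(s)T+|s|^2\boldsymbol{I}\text{ is not invertible}\}$. $B_1^s(\Omega_q)$ is the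 set of $T\in L_r(\mathcal{H}_q)$ with: (a) $\Omega_q\subseteq\sigma_s(T)$; (b) $\mathrm{ran}(T^2-2\mathrm{Re}(\omega)T+|\omega|^2)=\mathcal{H}_q$ for all $\omega\in\Omega_q$; (c) $\bigvee_{\mathbb{H}}\{\ker(T^2-2\mathrm{Re}(\omega)T+|\omega|^2):\omega\in\Omega_q\}=\mathcal{H}_q$; (d) $\dim_{\mathbb{H}}\ker(T^2-2\mathrm{Re}(\omega)T+|\omega|^2)=1$ for all $\omega\in\Omega_q$. Complex representation: fix an orthonormal basis $\{e_n\}$ of $\mathcal{H}_q$. Writing the coordinate column of $x\in\mathcal{H}_q$ as $x_1+\boldsymbol{j}x_2$ with $x_1,x_2$ complex columns, put $x_{\mathbb{C}}=\begin{pmatrix} x_1 \\ x_2 \end{pmatrix}$ and $(\mathcal{H}_q)_{\mathbb{C}}=\{x_{\mathbb{C}}:x\in\mathcal{H}_q\}$, a complex Hilbert space (a direct sum of two copies of $\ell^2$). If $T\in L_r(\mathcal{H}_q)$ has quaternionic matrix $A=A_1+\boldsymbol{j}A_2$ in the basis $\{e_n\}$, with $A_1,A_2$ complex matrices, then $T_{\mathbb{C}}$ is the complex linear operator on $(\mathcal{H}_q)_{\mathbb{C}}$ with matrix $\begin{pmatrix} A_1 & -\overline{A_2} \\ A_2 & \overline{A_1} \end{pmatrix}$; it satisfies $(Tx)_{\mathbb{C}}=T_{\mathbb{C}}x_{\mathbb{C}}$. $T,\widetilde T$ are quaternion unitarily equivalent if there is $U\in L_r(\mathcal{H}_q)$ with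 $U^*U=UU^*=\boldsymbol{I}$ and $UT=\widetilde TU$. *)

theory Defs
  imports "HOL-Analysis.Analysis"
begin

section \<open>Quaternions\<close>

text \<open>\<open>Quat a b c d\<close> stands for $a + b i + c j + d k$.\<close>

datatype quat = Quat (qRe: real) (qI: real) (qJ: real) (qK: real)

lemma quat_eq_iff:
  "p = q \<longleftrightarrow> qRe p = qRe q \<and> qI p = qI q \<and> qJ p = qJ q \<and> qK p = qK q"
  by (cases p; cases q) auto

instantiation quat :: real_algebra_1
begin

definition zero_quat :: quat where "0 = Quat 0 0 0 0"
definition one_quat :: quat where "1 = Quat 1 0 0 0"
definition plus_quat :: "quat \<Rightarrow> quat \<Rightarrow> quat" where
  "p + q = Quat (qRe p + qRe q) (qI p + qI q) (qJ p + qJ q) (qK p + qK q)"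
definition uminus_quat :: "quat \<Rightarrow> quat" where
  "- p = Quat (- qRe p) (- qI p) (- qJ p) (- qK p)"
definition minus_quat :: "quat \<Rightarrow> quat \<Rightarrow> quat" where
  "p - q = Quat (qRe p - qRe q) (qI p - qI q) (qJ p - qJ q) (qK p - qK q)"
definition scaleR_quat :: "real \<Rightarrow> quat \<Rightarrow> quat" where
  "r *\<^sub>R q = Quat (r * qRe q) (r * qI q) (r * qJ q) (r * qK q)"
definition times_quat :: "quat \<Rightarrow> quat \<Rightarrow> quat" where
  "p * q = Quat
    (qRe p * qRe q - qI p * qI q - qJ p * qJ q - qK p * qK q)
    (qRe p * qI q + qI p * qRe q + qJ p * qK q - qK p * qJ q)
    (qRe p * qJ q - qI p * qK q + qJ p * qRe q + qK p * qI q)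
    (qRe p * qK q + qI p * qJ q - qJ p * qI q + qK p * qRe q)"

instance
  by standard
    (simp_all add: quat_eq_iff zero_quat_def one_quat_def plus_quat_def uminus_quat_def
      minus_quat_def scaleR_quat_def times_quat_def algebra_simps)

end

lemma quat_sel_simps [simp]:
  "qRe 0 = 0" "qI 0 = 0" "qJ 0 = 0" "qK 0 = 0"
  "qRe 1 = 1" "qI 1 = 0" "qJ 1 = 0" "qK 1 = 0"
  "qRe (p + q) = qRe p + qRe q" "qI (p + q) = qI p + qI q"
  "qJ (p + q) = qJ p + qJ q" "qK (p + q) = qK p + qK q"
  "qRe (- p) = - qRe p" "qI (- p) = - qI p" "qJ (- p) = - qJ p" "qK (- p) = - qK p"
  "qRe (p - q) = qRe p - qRe q" "qI (p - q) = qI p - qI q"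
  "qJ (p - q) = qJ p - qJ q" "qK (p - q) = qK p - qK q"
  "qRe (r *\<^sub>R q) = r * qRe q" "qI (r *\<^sub>R q) = r * qI q"
  "qJ (r *\<^sub>R q) = r * qJ q" "qK (r *\<^sub>R q) = r * qK q"
  by (simp_all add: zero_quat_def one_quat_def plus_quat_def uminus_quat_def
      minus_quat_def scaleR_quat_def)

lemma quat_times_sel:
  "qRe (p * q) = qRe p * qRe q - qI p * qI q - qJ p * qJ q - qK p * qK q"
  "qI (p * q) = qRe p * qI q + qI p * qRe q + qJ p * qK q - qK p * qJ q"
  "qJ (p * q) = qRe p * qJ q - qI p * qK q + qJ p * qRe q + qK p * qI q"
  "qK (p * q) = qRe p * qK q + qI p * qJ q - qJ p * qI q + qK p * qRe q"
  by (simp_all add: times_quat_def)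

instantiation quat :: real_inner
begin

definition inner_quat :: "quat \<Rightarrow> quat \<Rightarrow> real" where
  "inner p q = qRe p * qRe q + qI p * qI q + qJ p * qJ q + qK p * qK q"
definition norm_quat :: "quat \<Rightarrow> real" where
  "norm (q::quat) = sqrt (inner q q)"
definition sgn_quat :: "quat \<Rightarrow> quat" where
  "sgn (q::quat) = inverse (norm q) *\<^sub>R q"
definition dist_quat :: "quat \<Rightarrow> quat \<Rightarrow> real" where
  "dist (p::quat) q = norm (p - q)"
definition uniformity_quat :: "(quat \<times> quat) filter" where
  "uniformity = (INF e\<in>{0 <..}. principal {(x :: quat, y). dist x y < e})"
definition open_quat :: "quat set \<Rightarrow> bool" where
  "open (U :: quat set) \<longleftrightarrow> (\<forall>x\<in>U. eventually (\<lambda>(x', y). x' = x \<longrightarrow> y \<in> U) uniformity)"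

instance
proof
  fix p q z :: quat and r :: real
  show "inner p q = inner q p" by (simp add: inner_quat_def algebra_simps)
  show "inner (p + q) z = inner p z + inner q z" by (simp add: inner_quat_def algebra_simps)
  show "inner (r *\<^sub>R p) q = r * inner p q" by (simp add: inner_quat_def algebra_simps)
  show "0 \<le> inner p p" by (simp add: inner_quat_def)
  have "a * a + b * b + c * c + d * d = 0 \<longleftrightarrow> a = 0 \<and> b = 0 \<and> c = 0 \<and> d = 0"
    for a b c d :: real
    by (metis add.right_neutral add_nonneg_eq_0_iff mult_zero_right not_sum_squares_lt_zero
        add_nonneg_nonneg linorder_not_less sum_squares_eq_zero_iff zero_le_square)
  then show "inner p p = 0 \<longleftrightarrow> p = 0" by (simp add: inner_quat_def quat_eq_iff)
qed (fact norm_quat_def sgn_quat_def dist_quat_def uniformity_quat_def open_quat_def)+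

end

text \<open>The norm is $|q| = \sqrt{a^2+b^2+c^2+d^2}$, and it is multiplicative.\<close>

lemma norm_quat_sq: "(norm q)\<^sup>2 = (qRe q)\<^sup>2 + (qI q)\<^sup>2 + (qJ q)\<^sup>2 + (qK q)\<^sup>2" for q :: quat
  by (simp add: norm_eq_sqrt_inner) (simp add: inner_quat_def power2_eq_square)

instantiation quat :: real_normed_div_algebra
begin

definition quat_cnj :: "quat \<Rightarrow> quat" where
  "quat_cnj q = Quat (qRe q) (- qI q) (- qJ q) (- qK q)"
definition inverse_quat :: "quat \<Rightarrow> quat" where
  "inverse (q::quat) = inverse ((norm q)\<^sup>2) *\<^sub>R quat_cnj q"
definition divide_quat :: "quat \<Rightarrow> quat \<Rightarrow> quat" where
  "(p::quat) div q = p * inverse q"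

instance
proof
  fix p q :: quat
  have *: "quat_cnj q * q = (norm q)\<^sup>2 *\<^sub>R 1" "q * quat_cnj q = (norm q)\<^sup>2 *\<^sub>R 1" for q
    unfolding norm_quat_sq
    by (simp_all add: quat_eq_iff quat_times_sel quat_cnj_def power2_eq_square)
  show "q \<noteq> 0 \<Longrightarrow> inverse q * q = 1" "q \<noteq> 0 \<Longrightarrow> q * inverse q = 1"
    by (simp_all add: inverse_quat_def *)
  show "p div q = p * inverse q" by (fact divide_quat_def)
  show "inverse (0::quat) = 0"
    by (simp add: inverse_quat_def)
  have "(norm (p * q))\<^sup>2 = (norm p * norm q)\<^sup>2"
    unfolding power_mult_distrib norm_quat_sq quat_times_sel by algebra
  then show "norm (p * q) = norm p * norm q"
    by (simp add: power2_eq_iff_nonneg)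
qed

end

definition quat_sim :: "quat \<Rightarrow> quat \<Rightarrow> bool" where
  "quat_sim p q \<longleftrightarrow> norm p = norm q \<and> qRe p = qRe q"

definition axially_symmetric :: "quat set \<Rightarrow> bool" where
  "axially_symmetric S \<longleftrightarrow> (\<forall>x\<in>S. \<forall>y. quat_sim y x \<longrightarrow> y \<in> S)"

text \<open>The identification of $a + bi$ in the complex numbers with a quaternion, and the
  components of the decomposition $q = q_1 + j q_2$ with complex $q_1$, $q_2$. Since $ji = -k$,
  the imaginary part of $q_2$ is minus the $k$-coordinate.\<close>

definition quat_of_complex :: "complex \<Rightarrow> quat" where
  "quat_of_complex z = Quat (Re z) (Im z) 0 0"

definition quat_j :: quat where
  "quat_j = Quat 0 0 1 0"

definition cpart1 :: "quat \<Rightarrow> complex" where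
  "cpart1 q = Complex (qRe q) (qI q)"

definition cpart2 :: "quat \<Rightarrow> complex" where
  "cpart2 q = Complex (qJ q) (- qK q)"

lemma quat_cpart_decomp:
  "q = quat_of_complex (cpart1 q) + quat_j * quat_of_complex (cpart2 q)"
  by (simp add: quat_eq_iff quat_times_sel quat_of_complex_def quat_j_def cpart1_def cpart2_def)

lemma quat_cpart_unique:
  assumes "q = quat_of_complex z + quat_j * quat_of_complex w"
  shows "z = cpart1 q" "w = cpart2 q"
  using assms
  by (simp_all add: quat_times_sel quat_of_complex_def quat_j_def cpart1_def cpart2_def
      complex_eq_iff)


section \<open>Quaternionic Hilbert spaces\<close>

text \<open>A quaternionic Hilbert space carries the underlying real Banach space structure; the last
  axiom says that its norm is the one induced by the inner product, and contains positive
  definiteness.\<close>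

class quat_hilbert = banach +
  fixes scaleQ :: "'a \<Rightarrow> quat \<Rightarrow> 'a" (infixl "*\<^sub>Q" 75)
    and qinner :: "'a \<Rightarrow> 'a \<Rightarrow> quat"
  assumes scaleQ_add_left: "(x + y) *\<^sub>Q p = x *\<^sub>Q p + y *\<^sub>Q p"
    and scaleQ_add_right: "x *\<^sub>Q (p + q) = x *\<^sub>Q p + x *\<^sub>Q q"
    and scaleQ_scaleQ: "(x *\<^sub>Q p) *\<^sub>Q q = x *\<^sub>Q (p * q)"
    and scaleQ_of_real: "x *\<^sub>Q of_real r = r *\<^sub>R x"
    and qinner_commute: "qinner x y = quat_cnj (qinner y x)"
    and qinner_linear: "qinner (x *\<^sub>Q p + y *\<^sub>Q q) z = qinner x z * p + qinner y z * q"
    and qinner_self: "qinner x x = of_real ((norm x)\<^sup>2)"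

class separable_quat_hilbert = quat_hilbert +
  assumes separable: "\<exists>D. countable D \<and> (\<forall>x. \<forall>r>0. \<exists>d\<in>D. dist x d < r)"

definition qsubspace :: "'a::quat_hilbert set \<Rightarrow> bool" where
  "qsubspace S \<longleftrightarrow> 0 \<in> S \<and> (\<forall>x\<in>S. \<forall>y\<in>S. x + y \<in> S) \<and> (\<forall>x\<in>S. \<forall>q. x *\<^sub>Q q \<in> S)"

definition qspan :: "'a::quat_hilbert set \<Rightarrow> 'a set" where
  "qspan S = qsubspace hull S"

definition closed_qspan :: "'a::quat_hilbert set \<Rightarrow> 'a set" where
  "closed_qspan S = closure (qspan S)"

definition qindependent :: "'a::quat_hilbert set \<Rightarrow> bool" where
  "qindependent B \<longleftrightarrow>
    (\<forall>F u. finite F \<and> F \<subseteq> B \<and> (\<Sum>v\<in>F. v *\<^sub>Q u v) = 0 \<longrightarrow> (\<forall>v\<in>F. u v = 0))"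

text \<open>As for \<^const>\<open>Vector_Spaces.vector_space.dim\<close>, the value is \<open>0\<close> for infinite-dimensional
  subspaces.\<close>

definition qdim :: "'a::quat_hilbert set \<Rightarrow> nat" where
  "qdim V = (if \<exists>B. qindependent B \<and> qspan B = qspan V
    then card (SOME B. qindependent B \<and> qspan B = qspan V) else 0)"

definition qoperators :: "('a::quat_hilbert \<Rightarrow> 'a) set" where
  "qoperators = {T. bounded_linear T \<and> (\<forall>x q. T (x *\<^sub>Q q) = T x *\<^sub>Q q)}"

definition qinvertible :: "('a::quat_hilbert \<Rightarrow> 'a) \<Rightarrow> bool" where
  "qinvertible T \<longleftrightarrow> (\<exists>S\<in>qoperators. S \<circ> T = id \<and> T \<circ> S = id)"

text \<open>$T^2 - 2\,\mathrm{Re}(s)\,T + |s|^2 I$\<close>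

definition qpencil :: "('a::quat_hilbert \<Rightarrow> 'a) \<Rightarrow> quat \<Rightarrow> 'a \<Rightarrow> 'a" where
  "qpencil T s x = T (T x) - (2 * qRe s) *\<^sub>R T x + (norm s)\<^sup>2 *\<^sub>R x"

definition s_spectrum :: "('a::quat_hilbert \<Rightarrow> 'a) \<Rightarrow> quat set" where
  "s_spectrum T = {s. \<not> qinvertible (qpencil T s)}"

definition qker :: "('a::quat_hilbert \<Rightarrow> 'a) \<Rightarrow> 'a set" where
  "qker T = {x. T x = 0}"

definition B1s :: "quat set \<Rightarrow> ('a::quat_hilbert \<Rightarrow> 'a) set" where
  "B1s \<Omega> = {T \<in> qoperators.
     \<Omega> \<subseteq> s_spectrum T \<and>
     (\<forall>\<omega>\<in>\<Omega>. range (qpencil T \<omega>) = UNIV) \<and>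
     closed_qspan (\<Union>\<omega>\<in>\<Omega>. qker (qpencil T \<omega>)) = UNIV \<and>
     (\<forall>\<omega>\<in>\<Omega>. qdim (qker (qpencil T \<omega>)) = 1)}"

text \<open>\<open>V\<close> is the adjoint \<open>U\<^sup>*\<close> of \<open>U\<close>; it is unique, by definiteness of the inner product.\<close>

definition is_qadjoint :: "('a::quat_hilbert \<Rightarrow> 'a) \<Rightarrow> ('a \<Rightarrow> 'a) \<Rightarrow> bool" where
  "is_qadjoint U V \<longleftrightarrow> V \<in> qoperators \<and> (\<forall>x y. qinner (U x) y = qinner x (V y))"

definition qunitary :: "('a::quat_hilbert \<Rightarrow> 'a) \<Rightarrow> bool" where
  "qunitary U \<longleftrightarrow> U \<in> qoperators \<and> (\<exists>V. is_qadjoint U V \<and> V \<circ> U = id \<and> U \<circ> V = id)"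

definition qunitarily_equivalent :: "('a::quat_hilbert \<Rightarrow> 'a) \<Rightarrow> ('a \<Rightarrow> 'a) \<Rightarrow> bool" where
  "qunitarily_equivalent T T' \<longleftrightarrow> (\<exists>U. qunitary U \<and> U \<circ> T = T' \<circ> U)"


section \<open>The complex representation\<close>

text \<open>The basis is a family indexed by a set \<open>N\<close> of natural numbers, so that spaces of every finite
  dimension are covered along with the infinite-dimensional one. Coordinates and matrix entries with
  an index outside \<open>N\<close> are \<open>0\<close>. A column with two blocks is a function on \<^typ>\<open>nat + nat\<close>.\<close>

definition orthonormal_basis :: "nat set \<Rightarrow> (nat \<Rightarrow> 'a::quat_hilbert) \<Rightarrow> bool" where
  "orthonormal_basis N e \<longleftrightarrow>
    (\<forall>m\<in>N. \<forall>n\<in>N. qinner (e m) (e n) = (if m = n then 1 else 0)) \<and>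
    closed_qspan (e ` N) = UNIV"

definition qcoord :: "nat set \<Rightarrow> (nat \<Rightarrow> 'a::quat_hilbert) \<Rightarrow> 'a \<Rightarrow> nat \<Rightarrow> quat" where
  "qcoord N e x n = (if n \<in> N then qinner x (e n) else 0)"

definition qmatrix :: "nat set \<Rightarrow> (nat \<Rightarrow> 'a::quat_hilbert) \<Rightarrow> ('a \<Rightarrow> 'a) \<Rightarrow> nat \<Rightarrow> nat \<Rightarrow> quat" where
  "qmatrix N e T m n = (if n \<in> N then qcoord N e (T (e n)) m else 0)"

type_synonym ccolumn = "nat + nat \<Rightarrow> complex"

definition complex_column :: "nat set \<Rightarrow> (nat \<Rightarrow> 'a::quat_hilbert) \<Rightarrow> 'a \<Rightarrow> ccolumn" where
  "complex_column N e x =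
    case_sum (\<lambda>n. cpart1 (qcoord N e x n)) (\<lambda>n. cpart2 (qcoord N e x n))"

definition complex_space :: "nat set \<Rightarrow> (nat \<Rightarrow> 'a::quat_hilbert) \<Rightarrow> ccolumn set" where
  "complex_space N e = range (complex_column N e)"

fun complex_block :: "(nat \<Rightarrow> nat \<Rightarrow> complex) \<Rightarrow> (nat \<Rightarrow> nat \<Rightarrow> complex) \<Rightarrow>
    nat + nat \<Rightarrow> nat + nat \<Rightarrow> complex" where
  "complex_block A1 A2 (Inl m) (Inl n) = A1 m n"
| "complex_block A1 A2 (Inl m) (Inr n) = - cnj (A2 m n)"
| "complex_block A1 A2 (Inr m) (Inl n) = A2 m n"
| "complex_block A1 A2 (Inr m) (Inr n) = cnj (A1 m n)"

definition complex_operator ::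
    "nat set \<Rightarrow> (nat \<Rightarrow> 'a::quat_hilbert) \<Rightarrow> ('a \<Rightarrow> 'a) \<Rightarrow> ccolumn \<Rightarrow> ccolumn" where
  "complex_operator N e T v = (\<lambda>k. \<Sum>\<^sub>\<infinity>l.
     complex_block (\<lambda>m n. cpart1 (qmatrix N e T m n)) (\<lambda>m n. cpart2 (qmatrix N e T m n)) k l * v l)"

definition cinner :: "ccolumn \<Rightarrow> ccolumn \<Rightarrow> complex" where
  "cinner u v = (\<Sum>\<^sub>\<infinity>k. u k * cnj (v k))"

definition cnorm :: "ccolumn \<Rightarrow> real" where
  "cnorm u = sqrt (\<Sum>\<^sub>\<infinity>k. (cmod (u k))\<^sup>2)"

text \<open>In the following, \<open>K\<close> is a complex Hilbert space of columns with the inner product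
  \<^const>\<open>cinner\<close>, and operators on it matter only through their values on \<open>K\<close>.\<close>

definition bounded_complex_linear_on :: "ccolumn set \<Rightarrow> (ccolumn \<Rightarrow> ccolumn) \<Rightarrow> bool" where
  "bounded_complex_linear_on K V \<longleftrightarrow>
    V ` K \<subseteq> K \<and>
    (\<forall>u\<in>K. \<forall>v\<in>K. V (\<lambda>k. u k + v k) = (\<lambda>k. V u k + V v k)) \<and>
    (\<forall>a. \<forall>u\<in>K. V (\<lambda>k. a * u k) = (\<lambda>k. a * V u k)) \<and>
    (\<exists>C. \<forall>u\<in>K. cnorm (V u) \<le> C * cnorm u)"

definition is_cadjoint_on ::
    "ccolumn set \<Rightarrow> (ccolumn \<Rightarrow> ccolumn) \<Rightarrow> (ccolumn \<Rightarrow> ccolumn) \<Rightarrow> bool" where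
  "is_cadjoint_on K U V \<longleftrightarrow>
    bounded_complex_linear_on K V \<and> (\<forall>x\<in>K. \<forall>y\<in>K. cinner (U x) y = cinner x (V y))"

definition cunitary_on :: "ccolumn set \<Rightarrow> (ccolumn \<Rightarrow> ccolumn) \<Rightarrow> bool" where
  "cunitary_on K U \<longleftrightarrow> bounded_complex_linear_on K U \<and>
    (\<exists>V. is_cadjoint_on K U V \<and> (\<forall>x\<in>K. V (U x) = x \<and> U (V x) = x))"

definition cunitarily_equivalent_on ::
    "ccolumn set \<Rightarrow> (ccolumn \<Rightarrow> ccolumn) \<Rightarrow> (ccolumn \<Rightarrow> ccolumn) \<Rightarrow> bool" where
  "cunitarily_equivalent_on K S S' \<longleftrightarrow> (\<exists>U. cunitary_on K U \<and> (\<forall>x\<in>K. U (S x) = S' (U x)))"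

end

theory Submission
  imports Defs
begin

text \<open>
  Right multiplication by complex numbers makes a quaternionic Hilbert space a complex one, with
  inner product the first complex part of the quaternionic one. In an orthonormal basis
  \<open>e\<^sub>n\<close>, the vectors \<open>e\<^sub>n\<close> and \<open>e\<^sub>n j\<close> form a complex orthonormal basis, the column
  \<open>x\<^sub>C\<close> collects the coordinates of \<open>x\<close> in it, and \<open>T\<^sub>C\<close> is the matrix of \<open>T\<close> in it
  (\<open>cinner_complex_column\<close>, \<open>complex_operator_column\<close>). So a unitary equivalence of \<open>T\<^sub>C\<close> and
  \<open>T'\<^sub>C\<close> is a complex-linear surjective isometry \<open>W\<close> of the quaternionic space with \<open>W T = T' W\<close>,
  and it is a quaternionic equivalence if and only if it commutes with the antilinear map
  \<open>J x = x j\<close>. This settles one direction; for the other, \<open>W\<close> has to be corrected.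

  The map \<open>W' = J W J\<^sup>-\<^sup>1\<close> is another isometry intertwining \<open>T\<close> and \<open>T'\<close>. For
  \<open>\<omega>\<close> in \<open>\<Omega>\<close> let \<open>z\<close> be the point of the upper half-plane similar to \<open>\<omega>\<close>. Since the kernel of
  the pencil is one-dimensional over the quaternions and \<open>z\<close> is not real, the eigenspace
  \<open>{x. T x = x z}\<close> is one-dimensional over the complex numbers (\<open>B1s_eigenvector\<close>). Both
  isometries map it into the corresponding line for \<open>T'\<close>, so \<open>W' = W \<lambda>(\<omega>)\<close> there, with
  \<open>\<bar>\<lambda>(\<omega>)\<bar> = 1\<close>.

  The function \<open>\<lambda>\<close> is constant. As both maps are isometries, eigenvectors that belong to points
  with different values of \<open>\<lambda>\<close> are orthogonal. On the other hand, surjectivity of \<open>T - z\<close> is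
  stable, by the open mapping argument, in the quantitative sense that every eigenvector at one point
  has eigenvectors at all nearby points within a distance smaller than its norm
  (\<open>surj_kernel_perturbation\<close>), and those are not orthogonal to it. So \<open>\<lambda>\<close> is locally constant
  on the connected set \<open>\<Omega>\<close>.

  If \<open>\<lambda> = c\<close>, then \<open>W' = W c\<close> on a quaternionic subspace containing all kernels, hence everywhere
  by density (\<open>intertwining_cisometry_j\<close>). For a square root \<open>d\<close> of \<open>c\<close>, the map \<open>U = W d\<close>
  commutes with \<open>J\<close>, because \<open>J U J\<^sup>-\<^sup>1 = W' cnj d = W d\<^sup>2 cnj d = U\<close>, and it still intertwines
  \<open>T\<close> and \<open>T'\<close>.
\<close>

section \<open>Stability of kernels of surjective operators\<close>

text \<open>The successive approximation from the proof of the open mapping theorem: solving approximately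
  for the remaining error halves it each time, and the corrections form a geometrically convergent
  series.\<close>

lemma approximate_solutions_imp_solution:
  fixes B :: "'a::banach \<Rightarrow> 'b::real_normed_vector"
  assumes B: "bounded_linear B" and C: "0 \<le> C"
    and approx: "\<And>y. \<exists>x. norm x \<le> C * norm y \<and> norm (y - B x) \<le> norm y / 2"
  shows "\<exists>x. B x = y \<and> norm x \<le> 2 * C * norm y"
proof -
  interpret bounded_linear B by (fact B)
  obtain s where s: "norm (s y) \<le> C * norm y" "norm (y - B (s y)) \<le> norm y / 2" for y
    using approx by metis
  define r where "r n = ((\<lambda>y. y - B (s y)) ^^ n) y" for n
  have r_Suc: "r (Suc n) = r n - B (s (r n))" for n
    by (simp add: r_def)
  have r_le: "norm (r n) \<le> norm y * (1 / 2) ^ n" for n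
  proof (induction n)
    case (Suc n)
    then show ?case
      using s(2)[of "r n"] by (simp add: r_Suc)
  qed (simp add: r_def)
  have step_le: "norm (s (r n)) \<le> C * norm y * (1 / 2) ^ n" for n
    using order_trans[OF s(1) mult_left_mono[OF r_le C]] by (simp add: mult.assoc)
  have geo: "(\<lambda>n. C * norm y * (1 / 2) ^ n) sums (C * norm y * 2)"
    using sums_mult[OF geometric_sums[of "1/2::real"]] by simp
  have summable: "summable (\<lambda>n. norm (s (r n)))"
    by (rule summable_comparison_test'[OF sums_summable[OF geo]]) (use step_le in auto)
  have "(\<lambda>n. B (s (r n))) sums B (\<Sum>n. s (r n))"
    by (intro sums summable_sums summable_norm_cancel[OF summable])
  moreover have "(\<lambda>n. B (s (r n))) sums y"
  proof -
    have "(\<lambda>n. norm y * (1 / 2) ^ n) \<longlonglongrightarrow> norm y * 0"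
      by (intro tendsto_intros LIMSEQ_realpow_zero) auto
    then have "r \<longlonglongrightarrow> 0"
      using r_le by (intro tendsto_norm_zero_cancel[of r] Lim_null_comparison[of "\<lambda>n. norm (r n)"]) auto
    from telescope_sums'[OF this] show ?thesis
      by (simp add: r_Suc) (simp add: r_def)
  qed
  ultimately have "B (\<Sum>n. s (r n)) = y"
    using sums_unique2 by blast
  moreover have "norm (\<Sum>n. s (r n)) \<le> 2 * C * norm y"
  proof -
    have "norm (\<Sum>n. s (r n)) \<le> (\<Sum>n. norm (s (r n)))"
      using summable by (rule summable_norm)
    also have "\<dots> \<le> (\<Sum>n. C * norm y * (1 / 2) ^ n)"
      by (intro suminf_le step_le summable sums_summable[OF geo])
    finally show ?thesis
      using sums_unique[OF geo] by (simp add: mult_ac)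
  qed
  ultimately show ?thesis by blast
qed

text \<open>By the Baire category theorem the closure of the image of some ball has interior points;
  differences of two points of that image approximate all directions. The relative error \<open>1/4\<close>,
  instead of the \<open>1/2\<close> that the previous lemma allows, leaves room to perturb the operator.\<close>

lemma surj_imp_approximate_solutions:
  fixes A :: "'a::real_normed_vector \<Rightarrow> 'b::banach"
  assumes A: "bounded_linear A" and surj: "surj A"
  shows "\<exists>C\<ge>0. \<forall>y. \<exists>x. norm x \<le> C * norm y \<and> norm (y - A x) \<le> norm y / 4"
proof -
  interpret bounded_linear A by (fact A)
  define K where "K n = closure (A ` cball 0 (real n))" for n :: nat
  have "(\<Union>n. K n) = UNIV"
  proof -
    have "y \<in> (\<Union>n. K n)" for y
    proof -
      obtain x where "y = A x" using surj by blast
      moreover obtain n where "norm x \<le> real n" using real_arch_simple by blast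
      ultimately have "y \<in> K n"
        unfolding K_def by (intro closure_subset[THEN subsetD]) auto
      then show ?thesis by blast
    qed
    then show ?thesis by blast
  qed
  have "\<exists>n. interior (K n) \<noteq> {}"
  proof (rule ccontr)
    assume "\<not> ?thesis"
    then have "euclidean interior_of \<Union> (range K) = {}"
      by (intro Baire_category_alt) (auto simp: K_def completely_metrizable_space_euclidean)
    with \<open>(\<Union>n. K n) = UNIV\<close> show False by simp
  qed
  then obtain n y0 where "y0 \<in> interior (K n)" by blast
  then obtain \<rho> where \<rho>: "0 < \<rho>" "cball y0 \<rho> \<subseteq> K n"
    unfolding mem_interior_cball by blast
  have "\<exists>x. norm x \<le> 2 * real n / \<rho> * norm y \<and> norm (y - A x) \<le> norm y / 4" for y
  proof (cases "y = 0")
    case True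
    then show ?thesis by (intro exI[of _ 0]) (simp add: zero)
  next
    case False
    \<comment> \<open>Scaling \<open>y\<close> to length \<open>\<rho>\<close> places \<open>y0 + t y\<close> on the boundary of the ball.\<close>
    define t where "t = \<rho> / norm y"
    have t: "0 < t" using False \<rho> by (simp add: t_def)
    have "0 < \<rho> / 8" using \<rho> by simp
    have "y0 \<in> K n" "y0 + t *\<^sub>R y \<in> K n"
      using \<rho> False by (auto simp: subset_iff dist_norm t_def)
    moreover have "\<exists>a. norm a \<le> real n \<and> norm (A a - u) < \<rho> / 8" if "u \<in> K n" for u
      using closure_approachableD[OF that[unfolded K_def] \<open>0 < \<rho> / 8\<close>]
      by (auto simp: dist_norm norm_minus_commute)
    ultimately obtain a b where ab: "norm a \<le> real n" "norm (A a - y0) < \<rho> / 8"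
        "norm b \<le> real n" "norm (A b - (y0 + t *\<^sub>R y)) < \<rho> / 8"
      by blast
    define x where "x = (1 / t) *\<^sub>R (b - a)"
    have "norm x \<le> (1 / t) * (2 * real n)"
      using norm_triangle_ineq4[of b a] ab t unfolding x_def by (simp add: divide_right_mono)
    then have "norm x \<le> 2 * real n / \<rho> * norm y"
      by (simp add: t_def mult.commute)
    moreover have "norm (y - A x) \<le> norm y / 4"
    proof -
      have "y - A x = (1 / t) *\<^sub>R ((A a - y0) - (A b - (y0 + t *\<^sub>R y)))"
        using t by (simp add: x_def scale diff algebra_simps)
      moreover have "norm ((A a - y0) - (A b - (y0 + t *\<^sub>R y))) \<le> \<rho> / 4"
        using norm_triangle_ineq4[of "A a - y0" "A b - (y0 + t *\<^sub>R y)"] ab by linarith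
      ultimately have "norm (y - A x) \<le> (1 / t) * (\<rho> / 4)"
        using t mult_left_mono[of _ "\<rho> / 4" "1 / t"]
        by (metis norm_scaleR abs_of_nonneg less_imp_le zero_le_divide_1_iff)
      then show ?thesis using \<rho> by (simp add: t_def)
    qed
    ultimately show ?thesis by blast
  qed
  then show ?thesis
    using \<rho> by (intro exI[of _ "2 * real n / \<rho>"]) auto
qed

text \<open>The residual \<open>B v\<close> of a kernel vector \<open>v\<close> of \<open>A\<close> is small, so the uniform solvability of
  the perturbed equation yields a small correction \<open>x\<close> with \<open>B x = B v\<close>. The stated distance is what
  keeps the new kernel vector \<open>v - x\<close> from being orthogonal to \<open>v\<close>.\<close>

lemma surj_kernel_perturbation:
  fixes A :: "'a::banach \<Rightarrow> 'b::banach"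
  assumes A: "bounded_linear A" "surj A" and v: "A v = 0" "v \<noteq> 0"
  obtains \<delta> where "0 < \<delta>"
    "\<And>B. bounded_linear B \<Longrightarrow> (\<And>x. norm (B x - A x) \<le> \<delta> * norm x) \<Longrightarrow>
      \<exists>u. B u = 0 \<and> norm (u - v) < norm v"
proof -
  obtain C where C: "0 \<le> C"
      "\<And>y. \<exists>x. norm x \<le> C * norm y \<and> norm (y - A x) \<le> norm y / 4"
    using surj_imp_approximate_solutions[OF A] by blast
  define \<delta> where "\<delta> = 1 / (4 * C + 4)"
  have \<delta>: "0 < \<delta>" "\<delta> * C < 1 / 4"
    using C(1) by (simp_all add: \<delta>_def field_simps add_pos_nonneg)
  have "\<exists>u. B u = 0 \<and> norm (u - v) < norm v"
    if B: "bounded_linear B" and near: "\<And>x. norm (B x - A x) \<le> \<delta> * norm x" for B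
  proof -
    interpret bounded_linear B by (fact B)
    have "\<exists>x. norm x \<le> C * norm y \<and> norm (y - B x) \<le> norm y / 2" for y
    proof -
      obtain x where x: "norm x \<le> C * norm y" "norm (y - A x) \<le> norm y / 4"
        using C(2) by blast
      have "norm (B x - A x) \<le> \<delta> * (C * norm y)"
        using near[of x] mult_left_mono[OF x(1), of \<delta>] \<delta>(1) by linarith
      also have "\<dots> \<le> 1 / 4 * norm y"
        using \<delta>(2) mult_right_mono[of "\<delta> * C" "1 / 4" "norm y"] by (simp add: mult.assoc)
      finally have "norm (y - B x) \<le> norm y / 2"
        using norm_triangle_ineq4[of "y - A x" "B x - A x"] x(2) by (simp add: algebra_simps)
      with x(1) show ?thesis by blast
    qed
    from approximate_solutions_imp_solution[OF B C(1) this, of "B v"]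
    obtain x where x: "B x = B v" "norm x \<le> 2 * C * norm (B v)" by blast
    have "norm (B v) \<le> \<delta> * norm v"
      using near[of v] v by simp
    then have "norm x \<le> 2 * C * (\<delta> * norm v)"
      using x(2) C(1) by (smt (verit) mult_left_mono mult_nonneg_nonneg)
    also have "\<dots> = 2 * (\<delta> * C) * norm v" by (simp add: mult_ac)
    also have "\<dots> < norm v"
      using \<delta>(2) v(2) by simp
    finally show ?thesis
      using x(1) by (intro exI[of _ "v - x"]) (simp add: diff)
  qed
  with \<delta>(1) that show ?thesis by blast
qed

section \<open>The complex Hilbert space underlying a quaternionic one\<close>

lemma quat_of_complex_simps [simp]:
  "quat_of_complex 0 = 0" "quat_of_complex 1 = 1"
  "quat_of_complex (of_real r) = of_real r"
  by (simp_all add: quat_of_complex_def quat_eq_iff of_real_def)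

lemma quat_of_complex_add: "quat_of_complex (a + b) = quat_of_complex a + quat_of_complex b"
  and quat_of_complex_minus: "quat_of_complex (- a) = - quat_of_complex a"
  and quat_of_complex_mult: "quat_of_complex (a * b) = quat_of_complex a * quat_of_complex b"
  by (simp_all add: quat_of_complex_def quat_eq_iff quat_times_sel)

lemma norm_quat_of_complex [simp]: "norm (quat_of_complex c) = cmod c"
  by (simp add: norm_quat_def inner_quat_def quat_of_complex_def cmod_def power2_eq_square)

lemma quat_of_complex_j: "quat_of_complex c * quat_j = quat_j * quat_of_complex (cnj c)"
  by (simp add: quat_eq_iff quat_times_sel quat_of_complex_def quat_j_def)

lemma quat_j_j: "quat_j * quat_j = -1"
  by (simp add: quat_eq_iff quat_times_sel quat_j_def)

lemma norm_quat_j: "norm quat_j = 1"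
  by (simp add: norm_eq_sqrt_inner inner_quat_def quat_j_def)

lemma quat_cnj_simps [simp]:
  "qRe (quat_cnj q) = qRe q" "qI (quat_cnj q) = - qI q"
  "qJ (quat_cnj q) = - qJ q" "qK (quat_cnj q) = - qK q"
  by (simp_all add: quat_cnj_def)

lemma quat_cnj_mult: "quat_cnj (p * q) = quat_cnj q * quat_cnj p"
  by (simp add: quat_eq_iff quat_times_sel)

lemma quat_cnj_mult_self: "quat_cnj q * q = of_real ((norm q)\<^sup>2)"
  unfolding norm_quat_sq by (simp add: quat_eq_iff quat_times_sel of_real_def power2_eq_square)

lemma cpart_simps [simp]:
  "cpart1 0 = 0" "cpart1 (p + q) = cpart1 p + cpart1 q"
  "cpart1 (of_real r) = of_real r"
  "cpart1 (quat_cnj q) = cnj (cpart1 q)"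
  "cpart1 (p * quat_of_complex c) = cpart1 p * c"
  "cpart2 0 = 0"
  by (simp_all add: cpart1_def cpart2_def complex_eq_iff quat_times_sel quat_of_complex_def of_real_def)

lemma scaleQ_simps [simp]:
  fixes x :: "'a::quat_hilbert"
  shows "x *\<^sub>Q 0 = 0" "x *\<^sub>Q 1 = x" "0 *\<^sub>Q q = (0::'a)" "x *\<^sub>Q (- q) = - (x *\<^sub>Q q)"
    "(- x) *\<^sub>Q q = - (x *\<^sub>Q q)"
proof -
  show zr: "x *\<^sub>Q 0 = 0" using scaleQ_of_real[of x 0] by simp
  show "x *\<^sub>Q 1 = x" using scaleQ_of_real[of x 1] by simp
  show zl: "0 *\<^sub>Q q = (0::'a)" using scaleQ_add_left[of "0::'a" 0 q] by simp
  show "x *\<^sub>Q (- q) = - (x *\<^sub>Q q)"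
    using scaleQ_add_right[of x "- q" q] zr by (simp add: eq_neg_iff_add_eq_0)
  show "(- x) *\<^sub>Q q = - (x *\<^sub>Q q)"
    using scaleQ_add_left[of "- x" x q] zl by (simp add: eq_neg_iff_add_eq_0)
qed

lemma scaleQ_scaleR: "(r *\<^sub>R x) *\<^sub>Q q = r *\<^sub>R (x *\<^sub>Q q)"
  for x :: "'a::quat_hilbert"
proof -
  have "of_real r * q = q * of_real r" by (simp add: of_real_def)
  then show ?thesis by (metis scaleQ_of_real scaleQ_scaleQ)
qed

lemma qinner_scale_left: "qinner (x *\<^sub>Q p) z = qinner x z * p"
  for x :: "'a::quat_hilbert"
  using qinner_linear[of x p x 0 z] by simp

lemma qinner_scale_right: "qinner x (z *\<^sub>Q p) = quat_cnj p * qinner x z"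
  for x :: "'a::quat_hilbert"
  by (metis qinner_commute qinner_scale_left quat_cnj_mult)

lemma qinner_zero [simp]: "qinner 0 z = 0" "qinner z 0 = 0"
  for z :: "'a::quat_hilbert"
proof -
  show "qinner 0 z = 0" using qinner_scale_left[of 0 0 z] by simp
  then show "qinner z 0 = 0" by (subst qinner_commute) (simp add: quat_cnj_def quat_eq_iff)
qed

lemma qinner_add_left: "qinner (x + y) z = qinner x z + qinner y z"
  for x :: "'a::quat_hilbert"
  using qinner_linear[of x 1 y 1 z] by simp

lemma norm_scaleQ: "norm (x *\<^sub>Q q) = norm x * norm q"
  for x :: "'a::quat_hilbert"
proof -
  have "of_real ((norm (x *\<^sub>Q q))\<^sup>2) = quat_cnj q * (of_real ((norm x)\<^sup>2) * q)"
    using qinner_self[of "x *\<^sub>Q q"] qinner_self[of x]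
    by (simp add: qinner_scale_left qinner_scale_right mult.assoc)
  also have "\<dots> = of_real ((norm x)\<^sup>2) * (quat_cnj q * q)"
    by (simp add: of_real_def)
  also have "\<dots> = of_real ((norm x * norm q)\<^sup>2)"
    by (simp only: quat_cnj_mult_self power_mult_distrib of_real_mult)
  finally show ?thesis
    unfolding of_real_eq_iff by (simp add: power2_eq_iff_nonneg)
qed

lemma bounded_linear_scaleQ: "bounded_linear (\<lambda>x::'a::quat_hilbert. x *\<^sub>Q q)"
  by (rule bounded_linear_intro[where K = "norm q"])
    (simp_all add: scaleQ_add_left scaleQ_scaleR norm_scaleQ)

text \<open>The complex structure: \<open>cscale\<close> acts on the right, and \<open>hinner\<close> is linear in its first
  argument, as \<^const>\<open>qinner\<close> is.\<close>

definition cscale :: "'a::quat_hilbert \<Rightarrow> complex \<Rightarrow> 'a" (infixl "*\<^sub>C" 75) where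
  "x *\<^sub>C c = x *\<^sub>Q quat_of_complex c"

definition hinner :: "'a::quat_hilbert \<Rightarrow> 'a \<Rightarrow> complex" where
  "hinner x y = cpart1 (qinner x y)"

lemma cscale_simps [simp]: "x *\<^sub>C 0 = 0" "x *\<^sub>C 1 = x" "0 *\<^sub>C c = (0::'a::quat_hilbert)"
  "(- x) *\<^sub>C c = - (x *\<^sub>C c)" "x *\<^sub>C (- c) = - (x *\<^sub>C c)"
  by (simp_all add: cscale_def quat_of_complex_minus)

lemma cscale_add_left: "(x + y) *\<^sub>C c = x *\<^sub>C c + y *\<^sub>C c"
  and cscale_add_right: "x *\<^sub>C (c + d) = x *\<^sub>C c + x *\<^sub>C d"
  and cscale_cscale: "x *\<^sub>C c *\<^sub>C d = x *\<^sub>C (c * d)"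
  by (simp_all add: cscale_def quat_of_complex_add quat_of_complex_mult scaleQ_add_left
      scaleQ_add_right scaleQ_scaleQ)

lemma cscale_diff_left: "(x - y) *\<^sub>C c = x *\<^sub>C c - y *\<^sub>C c"
  and cscale_diff_right: "x *\<^sub>C (c - d) = x *\<^sub>C c - x *\<^sub>C d"
  using cscale_add_left[of x "- y" c] cscale_add_right[of x c "- d"] by simp_all

lemma cscale_of_real: "x *\<^sub>C of_real r = r *\<^sub>R x"
  by (simp add: cscale_def scaleQ_of_real)

lemma norm_cscale: "norm (x *\<^sub>C c) = norm x * cmod c"
  by (simp add: cscale_def norm_scaleQ)

lemma bounded_linear_cscale: "bounded_linear (\<lambda>x. x *\<^sub>C c)"
  unfolding cscale_def by (rule bounded_linear_scaleQ)

lemma cscale_j: "x *\<^sub>C c *\<^sub>Q quat_j = x *\<^sub>Q quat_j *\<^sub>C cnj c"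
  by (simp add: cscale_def scaleQ_scaleQ quat_of_complex_j)

lemma scaleQ_j_j: "x *\<^sub>Q quat_j *\<^sub>Q quat_j = - x" for x :: "'a::quat_hilbert"
  by (simp add: scaleQ_scaleQ quat_j_j)

text \<open>A map that is additive and commutes with complex scalars and with \<open>j\<close> is therefore
  quaternion-linear.\<close>

lemma scaleQ_eq_cscale:
  "x *\<^sub>Q q = x *\<^sub>C cpart1 q + x *\<^sub>Q quat_j *\<^sub>C cpart2 q" for x :: "'a::quat_hilbert"
  unfolding cscale_def scaleQ_scaleQ
  by (subst quat_cpart_decomp) (simp add: scaleQ_add_right)

lemma hinner_add_left: "hinner (x + y) z = hinner x z + hinner y z"
  by (simp add: hinner_def qinner_add_left)

lemma hinner_cscale_left: "hinner (x *\<^sub>C c) y = hinner x y * c"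
  by (simp add: hinner_def cscale_def qinner_scale_left)

lemma hinner_commute: "hinner y x = cnj (hinner x y)"
  unfolding hinner_def by (subst qinner_commute) simp

lemma hinner_self: "hinner x x = of_real ((norm x)\<^sup>2)"
  by (simp only: hinner_def qinner_self cpart_simps)

lemma hinner_cscale_right: "hinner x (y *\<^sub>C c) = cnj c * hinner x y"
  by (subst (1 2) hinner_commute) (simp add: hinner_cscale_left)

lemma hinner_zero [simp]: "hinner 0 y = 0" "hinner x 0 = 0" for x y :: "'a::quat_hilbert"
  by (simp_all add: hinner_def)

lemma hinner_minus [simp]: "hinner (- x) y = - hinner x y" "hinner x (- y) = - hinner x y"
  for x y :: "'a::quat_hilbert"
  using hinner_cscale_left[of x "-1" y] hinner_cscale_right[of x y "-1"] by simp_all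

lemma hinner_add_right: "hinner z (x + y) = hinner z x + hinner z y"
  by (subst (1 2 3) hinner_commute) (simp add: hinner_add_left)

lemma hinner_diff_left: "hinner (x - y) z = hinner x z - hinner y z"
  using hinner_add_left[of x "- y" z] by simp

lemma hinner_sum_left: "hinner (sum f A) y = (\<Sum>k\<in>A. hinner (f k) y)"
  by (induction A rule: infinite_finite_induct) (simp_all add: hinner_add_left)

lemma hinner_sum_right: "hinner x (sum f A) = (\<Sum>k\<in>A. hinner x (f k))"
  by (induction A rule: infinite_finite_induct) (simp_all add: hinner_add_right)

text \<open>Right multiplication by \<open>j\<close> is antiunitary for the complex structure.\<close>

lemma hinner_j_j: "hinner (x *\<^sub>Q quat_j) (y *\<^sub>Q quat_j) = cnj (hinner x y)"
  by (simp add: hinner_def qinner_scale_left qinner_scale_right complex_eq_iff cpart1_def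
      quat_times_sel quat_j_def)

text \<open>The complex inner product and \<open>j\<close> together determine the quaternionic inner product.\<close>

lemma cpart2_qinner: "cpart2 (qinner x y) = hinner x (y *\<^sub>Q quat_j)"
  by (simp add: hinner_def qinner_scale_right complex_eq_iff cpart1_def cpart2_def
      quat_times_sel quat_j_def)

lemma quat_eqI_cpart: "cpart1 p = cpart1 q \<Longrightarrow> cpart2 p = cpart2 q \<Longrightarrow> p = q"
  by (metis quat_cpart_decomp)

lemma norm_add_orthogonal:
  assumes "hinner x y = 0"
  shows "(norm (x + y))\<^sup>2 = (norm x)\<^sup>2 + (norm y)\<^sup>2"
proof -
  have "hinner y x = 0" using assms hinner_commute[of y x] by simp
  then have "hinner (x + y) (x + y) = hinner x x + hinner y y"
    using assms by (simp add: hinner_add_left hinner_add_right)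
  then have "complex_of_real ((norm (x + y))\<^sup>2) = of_real ((norm x)\<^sup>2 + (norm y)\<^sup>2)"
    unfolding hinner_self by simp
  then show ?thesis unfolding of_real_eq_iff .
qed

lemma cmod_hinner_le: "cmod (hinner x y) \<le> norm x * norm y"
proof (cases "y = 0")
  case False
  define p where "p = y *\<^sub>C (hinner x y / of_real ((norm y)\<^sup>2))"
  have "hinner p p = hinner x p"
    using False by (simp add: p_def hinner_cscale_left hinner_cscale_right hinner_self[of y])
  then have "hinner (x - p) p = 0"
    by (simp add: hinner_diff_left)
  from norm_add_orthogonal[OF this] have "(norm p)\<^sup>2 \<le> (norm x)\<^sup>2"
    by simp
  then have "norm p \<le> norm x"
    by (simp add: power2_le_iff_abs_le)
  moreover have "norm p * norm y = cmod (hinner x y)"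
    using False by (simp add: p_def norm_cscale norm_divide norm_power norm_mult power2_eq_square)
  ultimately show ?thesis
    by (metis mult_right_mono norm_ge_zero)
qed simp

lemma bounded_linear_hinner_left: "bounded_linear (\<lambda>x. hinner x y)"
proof (rule bounded_linear_intro[where K = "norm y"])
  show "hinner (r *\<^sub>R x) y = r *\<^sub>R hinner x y" for r x
    using hinner_cscale_left[of x "of_real r" y] by (simp add: cscale_of_real scaleR_conv_of_real)
qed (simp_all add: hinner_add_left cmod_hinner_le)

section \<open>The complex orthonormal basis and the matrix representation\<close>

text \<open>The complex orthonormal basis \<open>e\<^sub>n\<close>, \<open>e\<^sub>n j\<close>, extended by \<open>0\<close> to indices outside \<open>N\<close>
  so that sums can range over the whole type.\<close>

definition cbasis :: "nat set \<Rightarrow> (nat \<Rightarrow> 'a::quat_hilbert) \<Rightarrow> nat + nat \<Rightarrow> 'a" where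
  "cbasis N e = case_sum (\<lambda>n. if n \<in> N then e n else 0) (\<lambda>n. if n \<in> N then e n *\<^sub>Q quat_j else 0)"

lemma complex_column_eq_hinner: "complex_column N e x k = hinner x (cbasis N e k)"
  by (cases k)
    (simp_all add: complex_column_def cbasis_def qcoord_def cpart2_qinner flip: hinner_def)

definition cpartial :: "nat set \<Rightarrow> (nat \<Rightarrow> 'a::quat_hilbert) \<Rightarrow> (nat + nat) set \<Rightarrow> 'a \<Rightarrow> 'a" where
  "cpartial N e G x = (\<Sum>k\<in>G. cbasis N e k *\<^sub>C hinner x (cbasis N e k))"

lemma cpartial_diff: "cpartial N e G (x - y) = cpartial N e G x - cpartial N e G y"
  by (simp add: cpartial_def hinner_diff_left cscale_diff_right sum_subtractf)

context
  fixes N :: "nat set" and e :: "nat \<Rightarrow> 'a::quat_hilbert"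
  assumes onb: "orthonormal_basis N e"
begin

lemma hinner_cbasis:
  "hinner (cbasis N e k) (cbasis N e l) = (if k = l \<and> k \<in> N <+> N then 1 else 0)"
proof -
  have *: "qinner (e m) (e n) = (if m = n then 1 else 0)" if "m \<in> N" "n \<in> N" for m n
    using onb that by (simp add: orthonormal_basis_def)
  have [simp]: "cpart1 1 = 1" "cpart1 quat_j = 0" "cpart1 (quat_cnj quat_j) = 0"
      "cpart1 (quat_cnj quat_j * quat_j) = 1"
    by (simp_all add: cpart1_def complex_eq_iff quat_j_def quat_times_sel)
  show ?thesis
    by (cases k; cases l)
      (auto simp: cbasis_def hinner_def * qinner_scale_left qinner_scale_right)
qed

text \<open>The remainder is orthogonal to the partial sum, and Pythagoras applies.\<close>

lemma norm_diff_cpartial_le: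
  assumes "finite G"
  shows "norm (x - cpartial N e G x) \<le> norm x"
proof -
  let ?P = "cpartial N e G x" and ?f = "cbasis N e"
  have "hinner ?P (?f k) = hinner x (?f k)" if "k \<in> G" for k
  proof (cases "k \<in> N <+> N")
    case True
    have "hinner ?P (?f k) = (\<Sum>l\<in>G. if l = k then hinner x (?f k) else 0)"
      unfolding cpartial_def hinner_sum_left
      by (intro sum.cong) (use True in \<open>auto simp: hinner_cscale_left hinner_cbasis\<close>)
    then show ?thesis using that assms by simp
  next
    case False
    then have "?f k = 0" by (cases k) (auto simp: cbasis_def)
    then show ?thesis by simp
  qed
  then have "hinner (x - ?P) ?P = 0"
    by (subst (2) cpartial_def)
      (simp add: hinner_sum_right hinner_cscale_right hinner_diff_left)
  from norm_add_orthogonal[OF this] have "(norm (x - ?P))\<^sup>2 \<le> (norm x)\<^sup>2"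
    by simp
  then show ?thesis by (simp add: power2_le_iff_abs_le)
qed

text \<open>The vectors that are finite sums of their own quaternionic Fourier terms form a quaternionic
  subspace that contains the basis. Splitting every such term into its two complex terms shows
  that complex partial sums reproduce these vectors once they contain certain finitely many indices.\<close>

lemma cpartial_qspan:
  assumes "y \<in> qspan (e ` N)"
  shows "\<exists>F. finite F \<and> (\<forall>G. finite G \<and> F \<subseteq> G \<longrightarrow> cpartial N e G y = y)"
proof -
  define E where "E n = (if n \<in> N then e n else 0)" for n
  define S where "S = {y. \<exists>F. finite F \<and> y = (\<Sum>n\<in>F. E n *\<^sub>Q qinner y (E n)) \<and>
    (\<forall>n. n \<notin> F \<longrightarrow> qinner y (E n) = 0)}"
  have "qsubspace S"
    unfolding qsubspace_def
  proof (intro conjI ballI allI)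
    show "0 \<in> S" by (auto simp: S_def)
  next
    fix x y assume "x \<in> S" "y \<in> S"
    then obtain F G where F: "finite F" "x = (\<Sum>n\<in>F. E n *\<^sub>Q qinner x (E n))"
        "\<And>n. n \<notin> F \<Longrightarrow> qinner x (E n) = 0"
      and G: "finite G" "y = (\<Sum>n\<in>G. E n *\<^sub>Q qinner y (E n))"
        "\<And>n. n \<notin> G \<Longrightarrow> qinner y (E n) = 0"
      unfolding S_def by blast
    have x: "x = (\<Sum>n\<in>F \<union> G. E n *\<^sub>Q qinner x (E n))"
      using F G(1) by (subst F(2), intro sum.mono_neutral_left) auto
    have y: "y = (\<Sum>n\<in>F \<union> G. E n *\<^sub>Q qinner y (E n))"
      using G F(1) by (subst G(2), intro sum.mono_neutral_left) auto
    have xy: "x + y = (\<Sum>n\<in>F \<union> G. E n *\<^sub>Q qinner (x + y) (E n))"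
      by (simp only: qinner_add_left scaleQ_add_right sum.distrib flip: x y)
    show "x + y \<in> S"
      unfolding S_def
    proof (intro CollectI exI[of _ "F \<union> G"] conjI)
      show "\<forall>n. n \<notin> F \<union> G \<longrightarrow> qinner (x + y) (E n) = 0"
        using F(3) G(3) by (simp add: qinner_add_left)
    qed (fact xy | use F(1) G(1) in simp)+
  next
    fix x q assume "x \<in> S"
    then obtain F where F: "finite F" "x = (\<Sum>n\<in>F. E n *\<^sub>Q qinner x (E n))"
        "\<And>n. n \<notin> F \<Longrightarrow> qinner x (E n) = 0"
      unfolding S_def by blast
    interpret bounded_linear "\<lambda>x::'a. x *\<^sub>Q q" by (rule bounded_linear_scaleQ)
    have xq: "x *\<^sub>Q q = (\<Sum>n\<in>F. E n *\<^sub>Q qinner (x *\<^sub>Q q) (E n))"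
      by (subst F(2)) (simp add: sum scaleQ_scaleQ qinner_scale_left)
    show "x *\<^sub>Q q \<in> S"
      unfolding S_def
    proof (intro CollectI exI[of _ F] conjI)
      show "\<forall>n. n \<notin> F \<longrightarrow> qinner (x *\<^sub>Q q) (E n) = 0"
        using F(3) by (simp add: qinner_scale_left)
    qed (fact F(1) xq)+
  qed
  moreover have "e n \<in> S" if "n \<in> N" for n
    using that onb unfolding S_def orthonormal_basis_def
    by (intro CollectI exI[of _ "{n}"]) (auto simp: E_def)
  ultimately have "qspan (e ` N) \<subseteq> S"
    unfolding qspan_def by (intro hull_minimal) auto
  with assms obtain F where F: "finite F" "y = (\<Sum>n\<in>F. E n *\<^sub>Q qinner y (E n))"
      "\<And>n. n \<notin> F \<Longrightarrow> qinner y (E n) = 0"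
    unfolding S_def by blast
  have cb: "cbasis N e (Inl n) = E n" "cbasis N e (Inr n) = E n *\<^sub>Q quat_j" for n
    by (simp_all add: cbasis_def E_def)
  have "cpartial N e G y = y" if "finite G" "F <+> F \<subseteq> G" for G
  proof -
    have "cpartial N e G y = cpartial N e (F <+> F) y"
      unfolding cpartial_def
    proof (intro sum.mono_neutral_right ballI that)
      fix k assume "k \<in> G - (F <+> F)"
      then obtain n where "n \<notin> F" "k = Inl n \<or> k = Inr n"
        by (cases k) auto
      then show "cbasis N e k *\<^sub>C hinner y (cbasis N e k) = 0"
        using F(3) by (auto simp: cb hinner_def qinner_scale_right)
    qed
    also have "\<dots> = (\<Sum>n\<in>F. E n *\<^sub>Q qinner y (E n))"
      using F(1) by (simp add: cpartial_def sum.Plus cb scaleQ_eq_cscale[of _ "qinner y _"]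
          cpart2_qinner hinner_def flip: sum.distrib)
    finally show ?thesis using F(2) by simp
  qed
  then show ?thesis using F(1) by (intro exI[of _ "F <+> F"]) simp
qed

text \<open>A partial sum that reproduces a vector \<open>y\<close> close to \<open>x\<close> moves \<open>x\<close> by at most
  \<open>norm (x - y)\<close>, since the complementary projection is a contraction.\<close>

lemma has_sum_cbasis: "((\<lambda>k. cbasis N e k *\<^sub>C hinner x (cbasis N e k)) has_sum x) UNIV"
  unfolding has_sum_def
proof (rule tendstoI)
  fix \<epsilon> :: real assume "0 < \<epsilon>"
  have "x \<in> closure (qspan (e ` N))"
    using onb by (simp add: orthonormal_basis_def closed_qspan_def)
  then obtain y where y: "y \<in> qspan (e ` N)" "norm (x - y) < \<epsilon>"
    using \<open>0 < \<epsilon>\<close> by (metis closure_approachable dist_norm norm_minus_commute)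
  obtain F where F: "finite F" "\<And>G. finite G \<Longrightarrow> F \<subseteq> G \<Longrightarrow> cpartial N e G y = y"
    using cpartial_qspan[OF y(1)] by blast
  have "dist (cpartial N e G x) x < \<epsilon>" if "finite G" "F \<subseteq> G" for G
  proof -
    have "x - cpartial N e G x = (x - y) - cpartial N e G (x - y)"
      by (simp add: cpartial_diff F(2)[OF that])
    then have "norm (x - cpartial N e G x) \<le> norm (x - y)"
      using norm_diff_cpartial_le[OF that(1), of "x - y"] by (simp only:)
    then show ?thesis using y(2) by (simp add: dist_norm norm_minus_commute)
  qed
  then show "\<forall>\<^sub>F G in finite_subsets_at_top UNIV.
      dist (\<Sum>k\<in>G. cbasis N e k *\<^sub>C hinner x (cbasis N e k)) x < \<epsilon>"
    unfolding eventually_finite_subsets_at_top cpartial_def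
    using F(1) by (intro exI[of _ F]) simp
qed

text \<open>Parseval's identity and the action of matrices on columns are both of this form: every matrix
  row is the coordinate sequence of a continuous functional, which makes its sums converge.\<close>

lemma infsum_cbasis:
  fixes h :: "'a \<Rightarrow> complex"
  assumes "bounded_linear h" and "\<And>x c. h (x *\<^sub>C c) = h x * c"
  shows "(\<Sum>\<^sub>\<infinity>k. h (cbasis N e k) * complex_column N e x k) = h x"
  using has_sum_bounded_linear[OF assms(1) has_sum_cbasis[of x]]
  by (intro infsumI) (simp add: assms(2) complex_column_eq_hinner)

lemma cinner_complex_column: "cinner (complex_column N e x) (complex_column N e y) = hinner x y"
  using infsum_cbasis[OF bounded_linear_hinner_left hinner_cscale_left, of y x]
  by (simp add: cinner_def complex_column_eq_hinner hinner_commute[of _ "cbasis N e _"] mult.commute)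

lemma cnorm_complex_column: "cnorm (complex_column N e x) = norm x"
proof -
  have "((\<lambda>k. Re (hinner (cbasis N e k *\<^sub>C hinner x (cbasis N e k)) x)) has_sum Re (hinner x x)) UNIV"
    by (intro has_sum_Re has_sum_bounded_linear[OF bounded_linear_hinner_left has_sum_cbasis])
  moreover have "Re (hinner (cbasis N e k *\<^sub>C hinner x (cbasis N e k)) x)
      = (cmod (complex_column N e x k))\<^sup>2" for k
    unfolding complex_column_eq_hinner hinner_cscale_left
    by (subst hinner_commute) (simp add: cmod_power2 flip: power2_eq_square)
  ultimately have "(\<Sum>\<^sub>\<infinity>k. (cmod (complex_column N e x k))\<^sup>2) = (norm x)\<^sup>2"
    by (intro infsumI) (simp add: hinner_self)
  then show ?thesis
    by (simp add: cnorm_def)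
qed

lemma complex_column_inject: "complex_column N e x = complex_column N e y \<longleftrightarrow> x = y"
proof
  assume "complex_column N e x = complex_column N e y"
  then have "hinner x (cbasis N e k) = hinner y (cbasis N e k)" for k
    by (metis complex_column_eq_hinner)
  then show "x = y"
    using has_sum_cbasis[of x] has_sum_cbasis[of y] by (auto intro: has_sum_unique)
qed simp

lemma complex_operator_column:
  assumes "T \<in> qoperators"
  shows "complex_operator N e T (complex_column N e x) = complex_column N e (T x)"
proof
  fix k
  interpret T: bounded_linear T using assms by (simp add: qoperators_def)
  have TQ: "T (x *\<^sub>Q q) = T x *\<^sub>Q q" for x q
    using assms by (simp add: qoperators_def)
  have block: "complex_block (\<lambda>m n. cpart1 (qmatrix N e T m n)) (\<lambda>m n. cpart2 (qmatrix N e T m n)) k l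
      = hinner (T (cbasis N e l)) (cbasis N e k)" for l
    by (cases k; cases l)
      (simp_all add: qmatrix_def qcoord_def cbasis_def TQ hinner_def T.zero qinner_scale_left
        qinner_scale_right cpart1_def cpart2_def complex_eq_iff quat_times_sel quat_j_def)
  show "complex_operator N e T (complex_column N e x) k = complex_column N e (T x) k"
    unfolding complex_operator_def block complex_column_eq_hinner[of N e "T x"]
    by (intro infsum_cbasis bounded_linear_compose[OF bounded_linear_hinner_left]
        T.bounded_linear_axioms) (simp add: TQ cscale_def flip: hinner_cscale_left)
qed

end

lemma complex_column_add:
    "complex_column N e (x + y) = (\<lambda>k. complex_column N e x k + complex_column N e y k)"
  and complex_column_cscale:
    "complex_column N e (x *\<^sub>C c) = (\<lambda>k. c * complex_column N e x k)"
  by (simp_all add: fun_eq_iff complex_column_eq_hinner hinner_add_left hinner_cscale_left mult.commute)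

section \<open>Eigenspaces over the half-plane\<close>

text \<open>The point of the closed upper half-plane that is similar to a given quaternion.\<close>

definition upper_rep :: "quat \<Rightarrow> complex" where
  "upper_rep q = Complex (qRe q) (sqrt ((norm q)\<^sup>2 - (qRe q)\<^sup>2))"

lemma norm_quat_ge_Re: "(qRe q)\<^sup>2 \<le> (norm q)\<^sup>2"
  by (simp add: norm_quat_sq)

lemma cmod_upper_rep: "cmod (upper_rep q) = norm q"
  using norm_quat_ge_Re[of q] by (simp add: upper_rep_def cmod_def)

lemma Im_upper_rep_pos:
  assumes "q \<notin> \<real>"
  shows "0 < Im (upper_rep q)"
proof -
  have "qI q \<noteq> 0 \<or> qJ q \<noteq> 0 \<or> qK q \<noteq> 0"
  proof (rule ccontr)
    assume "\<not> ?thesis"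
    then have "q = of_real (qRe q)" by (simp add: quat_eq_iff of_real_def)
    with assms show False by (metis Reals_of_real)
  qed
  then have "0 < (qI q)\<^sup>2 + (qJ q)\<^sup>2 + (qK q)\<^sup>2"
    by (smt (verit) zero_le_power2 zero_less_power2)
  then show ?thesis by (simp add: upper_rep_def norm_quat_sq)
qed

lemma continuous_upper_rep: "isCont upper_rep q"
proof -
  have "bounded_linear qRe"
    by (rule bounded_linear_intro[where K = 1])
      (auto intro!: power2_le_imp_le[of "\<bar>_\<bar>"] norm_quat_ge_Re)
  then have "isCont qRe q"
    by (intro linear_continuous_at)
  then have "isCont (\<lambda>q. of_real (qRe q) + \<i> * of_real (sqrt ((norm q)\<^sup>2 - (qRe q)\<^sup>2))) q"
    by (intro continuous_intros)
  then show ?thesis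
    unfolding upper_rep_def Complex_eq .
qed

lemma qoperatorsD:
  assumes "T \<in> qoperators"
  shows "bounded_linear T" "T (x *\<^sub>Q q) = T x *\<^sub>Q q" "T (x *\<^sub>C c) = T x *\<^sub>C c"
  using assms by (simp_all add: qoperators_def cscale_def)

definition eigen_shift :: "('a::quat_hilbert \<Rightarrow> 'a) \<Rightarrow> complex \<Rightarrow> 'a \<Rightarrow> 'a" where
  "eigen_shift T z x = T x - x *\<^sub>C z"

lemma bounded_linear_eigen_shift: "bounded_linear T \<Longrightarrow> bounded_linear (eigen_shift T z)"
  unfolding eigen_shift_def by (intro bounded_linear_sub bounded_linear_cscale)

text \<open>The quadratic pencil has the conjugate roots \<open>upper_rep \<omega>\<close> and its conjugate, and the two linear
  factors commute.\<close>

lemma qpencil_eq_eigen_shift: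
  assumes "T \<in> qoperators"
  shows "qpencil T \<omega> x = eigen_shift T (upper_rep \<omega>) (eigen_shift T (cnj (upper_rep \<omega>)) x)"
    and "qpencil T \<omega> x = eigen_shift T (cnj (upper_rep \<omega>)) (eigen_shift T (upper_rep \<omega>) x)"
proof -
  interpret T: bounded_linear T using assms by (rule qoperatorsD)
  let ?z = "upper_rep \<omega>"
  have "T x *\<^sub>C ?z + T x *\<^sub>C cnj ?z = (2 * qRe \<omega>) *\<^sub>R T x"
    by (simp add: complex_add_cnj upper_rep_def flip: cscale_add_right cscale_of_real)
  moreover have "x *\<^sub>C (?z * cnj ?z) = (norm \<omega>)\<^sup>2 *\<^sub>R x"
    by (simp only: complex_norm_square[symmetric] cmod_upper_rep cscale_of_real)
  ultimately show "qpencil T \<omega> x = eigen_shift T ?z (eigen_shift T (cnj ?z) x)"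
      "qpencil T \<omega> x = eigen_shift T (cnj ?z) (eigen_shift T ?z x)"
    by (simp_all add: qpencil_def eigen_shift_def T.diff qoperatorsD(3)[OF assms] cscale_diff_left
        cscale_cscale mult.commute) (simp_all add: algebra_simps)
qed

lemma qsubspace_qker:
  assumes "T \<in> qoperators"
  shows "qsubspace (qker (qpencil T \<omega>))"
proof -
  interpret T: bounded_linear T using assms by (rule qoperatorsD)
  have "qpencil T \<omega> (x + y) = qpencil T \<omega> x + qpencil T \<omega> y" for x y
    by (simp add: qpencil_def T.add algebra_simps)
  moreover have "qpencil T \<omega> (x *\<^sub>Q q) = qpencil T \<omega> x *\<^sub>Q q" for x q
  proof -
    interpret Q: bounded_linear "\<lambda>x::'a. x *\<^sub>Q q" by (rule bounded_linear_scaleQ)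
    show ?thesis
      by (simp add: qpencil_def Q.add Q.diff Q.scale qoperatorsD(2)[OF assms])
  qed
  moreover have "qpencil T \<omega> 0 = 0" by (simp add: qpencil_def T.zero)
  ultimately show ?thesis by (simp add: qsubspace_def qker_def)
qed

lemma qdim_1_imp_range:
  assumes "qsubspace V" and "qdim V = 1"
  obtains b where "b \<noteq> 0" "V = range (\<lambda>q. b *\<^sub>Q q)"
proof -
  define P where "P B \<longleftrightarrow> qindependent B \<and> qspan B = qspan V" for B :: "'a set"
  have "\<exists>B. P B" and "card (SOME B. P B) = 1"
    using assms(2) by (auto simp: qdim_def P_def split: if_splits)
  then obtain b where "P {b}"
    by (metis card_1_singletonE someI_ex)
  then have b: "qindependent {b}" "qspan {b} = qspan V" by (simp_all add: P_def)
  have "b \<noteq> 0"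
    using b(1)[unfolded qindependent_def, rule_format, of "{b}" "\<lambda>_. 1" b] by auto
  moreover have "qspan V = V"
    using assms(1) by (simp add: qspan_def hull_same)
  moreover have "qspan {b} = range (\<lambda>q. b *\<^sub>Q q)"
    unfolding qspan_def
  proof (rule hull_unique)
    show "{b} \<subseteq> range (\<lambda>q. b *\<^sub>Q q)" by (auto intro: range_eqI[of _ _ 1])
    show "qsubspace (range (\<lambda>q. b *\<^sub>Q q))"
      unfolding qsubspace_def
      by (auto intro: range_eqI[of _ _ 0] simp: scaleQ_scaleQ simp flip: scaleQ_add_right)
    show "range (\<lambda>q. b *\<^sub>Q q) \<subseteq> S" if "{b} \<subseteq> S" "qsubspace S" for S
      using that by (auto simp: qsubspace_def)
  qed
  ultimately show ?thesis using b(2) that by simp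
qed

lemma B1sD:
  assumes "T \<in> B1s \<Omega>"
  shows "T \<in> qoperators" "closed_qspan (\<Union>\<omega>\<in>\<Omega>. qker (qpencil T \<omega>)) = UNIV"
    "\<omega> \<in> \<Omega> \<Longrightarrow> range (qpencil T \<omega>) = UNIV" "\<omega> \<in> \<Omega> \<Longrightarrow> qdim (qker (qpencil T \<omega>)) = 1"
  using assms by (simp_all add: B1s_def)

text \<open>A nonzero kernel vector \<open>b\<close> of the pencil yields an eigenvector for one of the two roots:
  either the factor of the conjugate root maps it to an eigenvector, or it kills \<open>b\<close> and then
  \<open>b j\<close> is an eigenvector, as \<open>j\<close> conjugates complex scalars. The kernel is then
  \<open>v \<complex> + v j \<complex>\<close>, and \<open>T\<close> acts on the second summand by the conjugate of \<open>upper_rep \<omega>\<close>, which differs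
  from \<open>upper_rep \<omega>\<close> because \<open>\<omega>\<close> is not real; so every eigenvector lies in the first.\<close>

lemma B1s_eigenvector:
  assumes T: "T \<in> B1s \<Omega>" and \<omega>: "\<omega> \<in> \<Omega>" "\<omega> \<notin> \<real>"
  obtains v where "v \<noteq> 0" "T v = v *\<^sub>C upper_rep \<omega>"
    "qker (qpencil T \<omega>) = range (\<lambda>q. v *\<^sub>Q q)"
    "\<And>x. T x = x *\<^sub>C upper_rep \<omega> \<Longrightarrow> \<exists>c. x = v *\<^sub>C c"
proof -
  note Top = B1sD(1)[OF T]
  interpret T: bounded_linear T using Top by (rule qoperatorsD)
  let ?z = "upper_rep \<omega>" and ?K = "qker (qpencil T \<omega>)"
  obtain b where b: "b \<noteq> 0" "?K = range (\<lambda>q. b *\<^sub>Q q)"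
    using qdim_1_imp_range[OF qsubspace_qker[OF Top] B1sD(4)[OF T \<omega>(1)]] .
  have "b \<in> ?K" unfolding b(2) by (auto intro: range_eqI[of _ _ 1])
  have "\<exists>v\<in>?K. v \<noteq> 0 \<and> T v = v *\<^sub>C ?z"
  proof (cases "eigen_shift T (cnj ?z) b = 0")
    case True
    then have "T (b *\<^sub>Q quat_j) = b *\<^sub>Q quat_j *\<^sub>C ?z"
      by (simp add: eigen_shift_def qoperatorsD(2)[OF Top] cscale_j)
    moreover have "norm (b *\<^sub>Q quat_j) \<noteq> 0"
      using b(1) by (simp only: norm_scaleQ norm_quat_j) simp
    ultimately show ?thesis using b(2) by (intro bexI[of _ "b *\<^sub>Q quat_j"]) auto
  next
    case False
    let ?u = "eigen_shift T (cnj ?z) b"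
    have u: "eigen_shift T ?z ?u = 0"
      using \<open>b \<in> ?K\<close> qpencil_eq_eigen_shift(1)[OF Top] by (simp add: qker_def)
    then have "?u \<in> ?K"
      unfolding qker_def qpencil_eq_eigen_shift(2)[OF Top]
      by (simp add: eigen_shift_def[of _ _ 0] T.zero)
    with u False show ?thesis
      by (intro bexI[of _ ?u]) (simp_all add: eigen_shift_def[of T "upper_rep \<omega>"])
  qed
  then obtain v where v: "v \<in> ?K" "v \<noteq> 0" "T v = v *\<^sub>C ?z" by blast
  from v(1) b(2) obtain q where q: "v = b *\<^sub>Q q" by blast
  with v(2) have "q \<noteq> 0" by auto
  have "b = v *\<^sub>Q inverse q"
    using \<open>q \<noteq> 0\<close> by (simp add: q scaleQ_scaleQ)
  then have K: "?K = range (\<lambda>q. v *\<^sub>Q q)"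
    unfolding b(2) using q by (auto simp: image_iff scaleQ_scaleQ) (metis scaleQ_scaleQ)+
  have "\<exists>c. x = v *\<^sub>C c" if "T x = x *\<^sub>C ?z" for x
  proof -
    from that have "x \<in> ?K"
      unfolding qker_def qpencil_eq_eigen_shift(2)[OF Top]
      by (simp add: eigen_shift_def T.zero)
    then obtain q where "x = v *\<^sub>Q q" using K by blast
    then obtain a b where x: "x = v *\<^sub>C a + v *\<^sub>Q quat_j *\<^sub>C b"
      by (metis scaleQ_eq_cscale)
    have "T x = v *\<^sub>C (?z * a) + v *\<^sub>Q quat_j *\<^sub>C (cnj ?z * b)"
      by (simp add: x T.add qoperatorsD(2,3)[OF Top] v(3) cscale_cscale cscale_j)
    moreover have "x *\<^sub>C ?z = v *\<^sub>C (?z * a) + v *\<^sub>Q quat_j *\<^sub>C (?z * b)"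
      by (simp add: x cscale_add_left cscale_cscale mult.commute)
    ultimately have "v *\<^sub>Q quat_j *\<^sub>C (?z * b - cnj ?z * b) = 0"
      using that by (simp add: cscale_diff_right)
    then have "norm (v *\<^sub>Q quat_j *\<^sub>C ((?z - cnj ?z) * b)) = 0"
      by (simp add: left_diff_distrib)
    then have "(?z - cnj ?z) * b = 0"
      using v(2) by (simp only: norm_cscale norm_scaleQ norm_quat_j) simp
    moreover have "?z - cnj ?z \<noteq> 0"
      using Im_upper_rep_pos[OF \<omega>(2)] by (simp add: complex_eq_iff)
    ultimately show ?thesis using x by auto
  qed
  with v(2,3) K that show ?thesis by blast
qed

text \<open>As the left factor of the surjective pencil, \<open>eigen_shift T (upper_rep \<omega>)\<close> is surjective, so its
  kernel is stable. A vector at distance less than \<open>norm v\<close> from \<open>v\<close> is not orthogonal to \<open>v\<close>.\<close>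

lemma B1s_eigenvectors_nearby:
  assumes T: "T \<in> B1s \<Omega>" and \<omega>: "\<omega> \<in> \<Omega>"
    and v: "v \<noteq> 0" "T v = v *\<^sub>C upper_rep \<omega>"
  obtains \<epsilon> where "0 < \<epsilon>"
    "\<And>\<eta>. dist \<eta> \<omega> < \<epsilon> \<Longrightarrow> \<exists>u. T u = u *\<^sub>C upper_rep \<eta> \<and> hinner u v \<noteq> 0"
proof -
  note Top = B1sD(1)[OF T]
  let ?z = "upper_rep \<omega>"
  have "surj (eigen_shift T ?z)"
    using B1sD(3)[OF T \<omega>] unfolding qpencil_eq_eigen_shift(1)[OF Top, abs_def] surj_def
    by (metis surj_def)
  moreover have "eigen_shift T ?z v = 0" using v by (simp add: eigen_shift_def)
  ultimately obtain \<delta> where \<delta>: "0 < \<delta>"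
    "\<And>B. bounded_linear B \<Longrightarrow> (\<And>x. norm (B x - eigen_shift T ?z x) \<le> \<delta> * norm x) \<Longrightarrow>
      \<exists>u. B u = 0 \<and> norm (u - v) < norm v"
    using surj_kernel_perturbation[OF bounded_linear_eigen_shift[OF qoperatorsD(1)[OF Top]]] v(1)
    by metis
  obtain \<epsilon> where \<epsilon>: "0 < \<epsilon>" "\<And>\<eta>. dist \<eta> \<omega> < \<epsilon> \<Longrightarrow> dist (upper_rep \<eta>) ?z < \<delta>"
    using continuous_upper_rep[of \<omega>] \<delta>(1) unfolding continuous_at_eps_delta by blast
  have "\<exists>u. T u = u *\<^sub>C upper_rep \<eta> \<and> hinner u v \<noteq> 0" if "dist \<eta> \<omega> < \<epsilon>" for \<eta>
  proof -
    have "norm (eigen_shift T (upper_rep \<eta>) x - eigen_shift T ?z x) \<le> \<delta> * norm x" for x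
    proof -
      have "eigen_shift T (upper_rep \<eta>) x - eigen_shift T ?z x = x *\<^sub>C (?z - upper_rep \<eta>)"
        by (simp add: eigen_shift_def cscale_diff_right)
      then have "norm (eigen_shift T (upper_rep \<eta>) x - eigen_shift T ?z x)
          = dist (upper_rep \<eta>) ?z * norm x"
        by (simp add: norm_cscale dist_norm norm_minus_commute)
      then show ?thesis using \<epsilon>(2)[OF that] by (simp add: mult_right_mono)
    qed
    from \<delta>(2)[OF bounded_linear_eigen_shift[OF qoperatorsD(1)[OF Top]] this]
    obtain u where u: "eigen_shift T (upper_rep \<eta>) u = 0" "norm (u - v) < norm v" by blast
    have "hinner u v \<noteq> 0"
    proof
      assume "hinner u v = 0"
      then have "(norm (u - v))\<^sup>2 = (norm u)\<^sup>2 + (norm v)\<^sup>2"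
        using norm_add_orthogonal[of u "- v"] by simp
      then have "(norm v)\<^sup>2 \<le> (norm (u - v))\<^sup>2" by simp
      with u(2) show False by (simp add: power2_le_iff_abs_le)
    qed
    with u(1) show ?thesis by (auto simp: eigen_shift_def)
  qed
  with \<epsilon>(1) that show ?thesis by blast
qed

section \<open>Rigidity of intertwining isometries\<close>

definition cisometry :: "('a::quat_hilbert \<Rightarrow> 'a) \<Rightarrow> bool" where
  "cisometry W \<longleftrightarrow> (\<forall>x y. W (x + y) = W x + W y) \<and> (\<forall>x c. W (x *\<^sub>C c) = W x *\<^sub>C c) \<and>
    (\<forall>x y. hinner (W x) (W y) = hinner x y)"

lemma cisometryD:
  assumes "cisometry W"
  shows "W (x + y) = W x + W y" "W (x *\<^sub>C c) = W x *\<^sub>C c" "hinner (W x) (W y) = hinner x y"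
    "norm (W x) = norm x" "bounded_linear W"
proof -
  show add: "W (x + y) = W x + W y" for x y
    using assms by (simp add: cisometry_def)
  show scale: "W (x *\<^sub>C c) = W x *\<^sub>C c" for x c
    using assms by (simp add: cisometry_def)
  show hinner: "hinner (W x) (W y) = hinner x y" for x y
    using assms by (simp add: cisometry_def)
  show norm: "norm (W x) = norm x" for x
    using hinner[of x x] unfolding hinner_self of_real_eq_iff by (simp add: power2_eq_iff_nonneg)
  show "bounded_linear W"
    by (rule bounded_linear_intro[where K = 1])
      (simp_all add: add norm scale flip: cscale_of_real)
qed

text \<open>The ratio \<open>l \<omega>\<close> of the two isometries on the eigenline at \<open>\<omega>\<close> is unimodular. Comparing inner
  products of eigenvectors \<open>u\<close>, \<open>v\<close> at \<open>\<eta>\<close>, \<open>\<omega>\<close> gives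
  \<open>hinner u v = hinner u v * l \<eta> * cnj (l \<omega>)\<close>, so \<open>l \<eta> = l \<omega>\<close> unless \<open>u\<close> and \<open>v\<close> are orthogonal.\<close>

lemma eigenvectors_intertwine_constant:
  assumes T: "T \<in> B1s \<Omega>" and T': "T' \<in> B1s \<Omega>"
    and \<Omega>: "connected \<Omega>" "\<Omega> \<inter> \<real> = {}"
    and W: "cisometry W" "\<And>x. W (T x) = T' (W x)"
    and W': "cisometry W'" "\<And>x. W' (T x) = T' (W' x)"
  obtains c where "cmod c = 1"
    "\<And>\<omega> x. \<omega> \<in> \<Omega> \<Longrightarrow> T x = x *\<^sub>C upper_rep \<omega> \<Longrightarrow> W' x = W x *\<^sub>C c"
proof -
  have "\<exists>l. cmod l = 1 \<and> (\<forall>x. T x = x *\<^sub>C upper_rep \<omega> \<longrightarrow> W' x = W x *\<^sub>C l)"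
    if \<omega>: "\<omega> \<in> \<Omega>" for \<omega>
  proof -
    have "\<omega> \<notin> \<real>" using \<omega> \<Omega>(2) by blast
    obtain v where v: "v \<noteq> 0" "T v = v *\<^sub>C upper_rep \<omega>"
        "\<And>x. T x = x *\<^sub>C upper_rep \<omega> \<Longrightarrow> \<exists>c. x = v *\<^sub>C c"
      using B1s_eigenvector[OF T \<omega> \<open>\<omega> \<notin> \<real>\<close>] by metis
    obtain v' where v': "\<And>x. T' x = x *\<^sub>C upper_rep \<omega> \<Longrightarrow> \<exists>c. x = v' *\<^sub>C c"
      using B1s_eigenvector[OF T' \<omega> \<open>\<omega> \<notin> \<real>\<close>] by metis
    \<comment> \<open>Both images lie on the eigenline of \<open>T'\<close>, which makes their ratio a scalar.\<close>
    have "T' (W v) = W v *\<^sub>C upper_rep \<omega>" "T' (W' v) = W' v *\<^sub>C upper_rep \<omega>"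
      using v(2) by (simp_all add: cisometryD(2)[OF W(1)] cisometryD(2)[OF W'(1)] flip: W(2) W'(2))
    then obtain a b where ab: "W v = v' *\<^sub>C a" "W' v = v' *\<^sub>C b"
      using v' by blast
    have "norm (v' *\<^sub>C a) = norm v" "norm (v' *\<^sub>C b) = norm v"
      using cisometryD(4)[OF W(1), of v] cisometryD(4)[OF W'(1), of v] ab by simp_all
    then have "norm v' * cmod a = norm v" "norm v' * cmod b = norm v"
      by (simp_all add: norm_cscale)
    moreover from this v(1) have "v' \<noteq> 0" "a \<noteq> 0" by auto
    ultimately have "cmod b = cmod a"
      by (metis mult_left_cancel norm_eq_zero)
    with \<open>a \<noteq> 0\<close> have "cmod (b / a) = 1"
      by (simp add: norm_divide)
    have "W' v = W v *\<^sub>C (b / a)" using \<open>a \<noteq> 0\<close> by (simp add: ab cscale_cscale)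
    then have "W' x = W x *\<^sub>C (b / a)" if "T x = x *\<^sub>C upper_rep \<omega>" for x
      using v(3)[OF that]
      by (auto simp: cisometryD(2)[OF W(1)] cisometryD(2)[OF W'(1)] cscale_cscale mult.commute)
    with \<open>cmod (b / a) = 1\<close> show ?thesis by blast
  qed
  then obtain l where l: "\<And>\<omega>. \<omega> \<in> \<Omega> \<Longrightarrow> cmod (l \<omega>) = 1"
      "\<And>\<omega> x. \<omega> \<in> \<Omega> \<Longrightarrow> T x = x *\<^sub>C upper_rep \<omega> \<Longrightarrow> W' x = W x *\<^sub>C l \<omega>"
    by metis
  have l_eq: "l \<eta> = l \<omega>" if "\<eta> \<in> \<Omega>" "\<omega> \<in> \<Omega>" "T u = u *\<^sub>C upper_rep \<eta>" "T v = v *\<^sub>C upper_rep \<omega>"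
    "hinner u v \<noteq> 0" for \<eta> \<omega> u v
  proof -
    have "hinner u v = hinner (W' u) (W' v)"
      by (simp add: cisometryD(3)[OF W'(1)])
    also have "\<dots> = hinner (W u *\<^sub>C l \<eta>) (W v *\<^sub>C l \<omega>)"
      using l(2) that by simp
    also have "\<dots> = hinner u v * (l \<eta> * cnj (l \<omega>))"
      by (simp add: hinner_cscale_left hinner_cscale_right cisometryD(3)[OF W(1)])
    finally have "l \<eta> * cnj (l \<omega>) = 1" using that(5) by simp
    moreover have "cnj (l \<omega>) * l \<omega> = 1"
      using l(1)[OF that(2)] complex_norm_square[of "l \<omega>"] by (simp add: mult.commute)
    ultimately show ?thesis
      by (metis mult.assoc mult.left_neutral mult.right_neutral)
  qed
  have "l constant_on \<Omega>"
  proof (rule locally_constant_imp_constant[OF \<Omega>(1)])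
    fix \<omega> assume \<omega>: "\<omega> \<in> \<Omega>"
    then have "\<omega> \<notin> \<real>" using \<Omega>(2) by blast
    obtain v where v: "v \<noteq> 0" "T v = v *\<^sub>C upper_rep \<omega>"
      using B1s_eigenvector[OF T \<omega> \<open>\<omega> \<notin> \<real>\<close>] by metis
    obtain \<epsilon> where \<epsilon>: "0 < \<epsilon>"
      "\<And>\<eta>. dist \<eta> \<omega> < \<epsilon> \<Longrightarrow> \<exists>u. T u = u *\<^sub>C upper_rep \<eta> \<and> hinner u v \<noteq> 0"
      using B1s_eigenvectors_nearby[OF T \<omega> v] by metis
    show "\<exists>S. openin (top_of_set \<Omega>) S \<and> \<omega> \<in> S \<and> (\<forall>\<eta>\<in>S. l \<eta> = l \<omega>)"
    proof (intro exI conjI ballI)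
      show "openin (top_of_set \<Omega>) (\<Omega> \<inter> ball \<omega> \<epsilon>)" by (simp add: openin_open_Int)
      show "\<omega> \<in> \<Omega> \<inter> ball \<omega> \<epsilon>" using \<omega> \<epsilon>(1) by simp
      show "l \<eta> = l \<omega>" if "\<eta> \<in> \<Omega> \<inter> ball \<omega> \<epsilon>" for \<eta>
        using \<epsilon>(2)[of \<eta>] l_eq[OF _ \<omega> _ v(2)] that by (auto simp: dist_commute)
    qed
  qed
  then obtain c where c: "\<And>\<omega>. \<omega> \<in> \<Omega> \<Longrightarrow> l \<omega> = c" by (auto simp: constant_on_def)
  show ?thesis
  proof (cases "\<Omega> = {}")
    case True
    then show ?thesis using that[of 1] by simp
  next
    case False
    then obtain \<omega> where "\<omega> \<in> \<Omega>" by blast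
    then have "cmod c = 1" using l(1) c by metis
    then show ?thesis using that l(2) c by metis
  qed
qed

text \<open>The conjugate \<open>J W J\<^sup>-\<^sup>1\<close> by the antiunitary map \<open>J x = x j\<close>; the sign comes from
  \<open>J\<^sup>-\<^sup>1 = - J\<close>.\<close>

lemma cisometry_j_conjugate:
  assumes "cisometry W"
  shows "cisometry (\<lambda>x. - (W (x *\<^sub>Q quat_j) *\<^sub>Q quat_j))"
proof -
  note D = cisometryD[OF assms]
  have c: "x *\<^sub>C c *\<^sub>Q quat_j = x *\<^sub>Q quat_j *\<^sub>C cnj c" for x :: 'a and c by (rule cscale_j)
  show ?thesis
    unfolding cisometry_def by (simp add: D c scaleQ_add_left hinner_j_j)
qed

text \<open>The vectors on which \<open>J W J\<^sup>-\<^sup>1 = W c\<close> form a closed complex subspace. It is invariant under \<open>J\<close>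
  because \<open>c\<close> is unimodular, hence it is a quaternionic subspace; one eigenvector in each kernel
  then forces it to contain all kernels, whose span is dense.\<close>

lemma intertwining_cisometry_j:
  assumes T: "T \<in> B1s \<Omega>" and T': "T' \<in> B1s \<Omega>"
    and \<Omega>: "connected \<Omega>" "\<Omega> \<inter> \<real> = {}"
    and W: "cisometry W" "\<And>x. W (T x) = T' (W x)"
  obtains c where "cmod c = 1" "\<And>x. W (x *\<^sub>Q quat_j) *\<^sub>Q quat_j = - (W x *\<^sub>C c)"
proof -
  note D = cisometryD[OF W(1)]
  interpret W: bounded_linear W by (rule D(5))
  interpret T': bounded_linear T' using B1sD(1)[OF T'] by (rule qoperatorsD)
  have "- (W (T x *\<^sub>Q quat_j) *\<^sub>Q quat_j) = T' (- (W (x *\<^sub>Q quat_j) *\<^sub>Q quat_j))" for x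
    by (simp add: T'.neg qoperatorsD(2)[OF B1sD(1)[OF T']] flip: W(2))
      (simp add: qoperatorsD(2)[OF B1sD(1)[OF T]])
  from eigenvectors_intertwine_constant[OF T T' \<Omega> W cisometry_j_conjugate[OF W(1)] this]
  obtain c where c: "cmod c = 1"
    "\<And>\<omega> x. \<omega> \<in> \<Omega> \<Longrightarrow> T x = x *\<^sub>C upper_rep \<omega> \<Longrightarrow> - (W (x *\<^sub>Q quat_j) *\<^sub>Q quat_j) = W x *\<^sub>C c"
    by metis
  have cc: "cnj c * c = 1"
    using c(1) complex_norm_square[of c] by (simp add: mult.commute)
  define S where "S = {x. W (x *\<^sub>Q quat_j) *\<^sub>Q quat_j = - (W x *\<^sub>C c)}"
  have add: "x + y \<in> S" if "x \<in> S" "y \<in> S" for x y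
    using that by (simp add: S_def D scaleQ_add_left cscale_add_left)
  have scale: "x *\<^sub>C a \<in> S" if "x \<in> S" for x a
    using that by (simp add: S_def D cscale_j cscale_cscale)
      (metis cscale_cscale cscale_simps(4) mult.commute)
  have j: "x *\<^sub>Q quat_j \<in> S" if "x \<in> S" for x
  proof -
    have "W (x *\<^sub>Q quat_j) *\<^sub>Q quat_j *\<^sub>Q quat_j = - (W x *\<^sub>C c *\<^sub>Q quat_j)"
      using that by (simp add: S_def)
    then have "W (x *\<^sub>Q quat_j) = W x *\<^sub>Q quat_j *\<^sub>C cnj c"
      by (simp add: scaleQ_j_j cscale_j)
    then have "W (x *\<^sub>Q quat_j) *\<^sub>C c = W x *\<^sub>Q quat_j"
      by (simp add: cscale_cscale cc)
    then show ?thesis by (simp add: S_def scaleQ_j_j W.neg)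
  qed
  have scaleQ: "x *\<^sub>Q q \<in> S" if "x \<in> S" for x q
    unfolding scaleQ_eq_cscale[of x q] by (intro add scale j that)
  have "0 \<in> S" by (simp add: S_def W.zero)
  then have "qsubspace S"
    using add scaleQ by (simp add: qsubspace_def)
  moreover have "qker (qpencil T \<omega>) \<subseteq> S" if \<omega>: "\<omega> \<in> \<Omega>" for \<omega>
  proof -
    have "\<omega> \<notin> \<real>" using \<omega> \<Omega>(2) by blast
    obtain v where v: "T v = v *\<^sub>C upper_rep \<omega>" "qker (qpencil T \<omega>) = range (\<lambda>q. v *\<^sub>Q q)"
      using B1s_eigenvector[OF T \<omega> \<open>\<omega> \<notin> \<real>\<close>] by metis
    have "v \<in> S" using c(2)[OF \<omega> v(1)] by (simp add: S_def neg_eq_iff_add_eq_0 eq_neg_iff_add_eq_0)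
    then show ?thesis using v(2) scaleQ by auto
  qed
  ultimately have "qspan (\<Union>\<omega>\<in>\<Omega>. qker (qpencil T \<omega>)) \<subseteq> S"
    unfolding qspan_def by (intro hull_minimal) auto
  moreover have "closed S"
    unfolding S_def
    by (intro closed_Collect_eq continuous_intros linear_continuous_on
        bounded_linear_compose[OF bounded_linear_scaleQ] bounded_linear_compose[OF bounded_linear_cscale]
        bounded_linear_compose[OF D(5)] bounded_linear_scaleQ D(5))
  ultimately have "S = UNIV"
    using B1sD(2)[OF T] closure_minimal unfolding closed_qspan_def by blast
  with c(1) that show ?thesis by (auto simp: S_def)
qed

lemma qunitary_if_cisometry:
  assumes U: "cisometry U" "surj U" and j: "\<And>x. U (x *\<^sub>Q quat_j) = U x *\<^sub>Q quat_j"
  shows "qunitary U"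
proof -
  note D = cisometryD[OF U(1)]
  interpret U: bounded_linear U by (rule D(5))
  have UQ: "U (x *\<^sub>Q q) = U x *\<^sub>Q q" for x q
    unfolding scaleQ_eq_cscale[of x q] scaleQ_eq_cscale[of "U x" q] by (simp add: D(1,2) j)
  have qinner: "qinner (U x) (U y) = qinner x y" for x y
    by (rule quat_eqI_cpart) (simp_all add: cpart2_qinner D(3) flip: hinner_def j)
  define V where "V = inv U"
  have UV: "U (V y) = y" for y
    using U(2) by (simp add: V_def surj_f_inv_f)
  have inj: "x = y" if "U x = U y" for x y
    using D(4)[of "x - y"] that by (simp add: U.diff)
  have "V \<in> qoperators"
    unfolding qoperators_def
  proof (intro CollectI conjI allI)
    show "bounded_linear V"
    proof (rule bounded_linear_intro[where K = 1])
      show "V (x + y) = V x + V y" for x y by (rule inj) (simp add: UV U.add)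
      show "V (r *\<^sub>R x) = r *\<^sub>R V x" for r x by (rule inj) (simp add: UV U.scale)
      show "norm (V x) \<le> norm x * 1" for x using D(4)[of "V x"] by (simp add: UV)
    qed
    show "V (x *\<^sub>Q q) = V x *\<^sub>Q q" for x q by (rule inj) (simp add: UV UQ)
  qed
  moreover have "qinner (U x) y = qinner x (V y)" for x y
    using qinner[of x "V y"] by (simp add: UV)
  moreover have "V (U x) = x" for x by (rule inj) (rule UV)
  ultimately show ?thesis
    unfolding qunitary_def is_qadjoint_def using UV D(5) UQ
    by (intro conjI exI[of _ V]) (auto simp: qoperators_def fun_eq_iff)
qed

text \<open>Replacing \<open>W\<close> by \<open>W d\<close> multiplies the constant \<open>c\<close> by the square of \<open>cnj d\<close>; the square root
  of \<open>c\<close> turns it into \<open>1\<close>.\<close>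

lemma qunitarily_equivalent_if_cisometry:
  assumes T: "T \<in> B1s \<Omega>" and T': "T' \<in> B1s \<Omega>"
    and \<Omega>: "connected \<Omega>" "\<Omega> \<inter> \<real> = {}"
    and W: "cisometry W" "surj W" "\<And>x. W (T x) = T' (W x)"
  shows "qunitarily_equivalent T T'"
proof -
  obtain c where c: "cmod c = 1" "\<And>x. W (x *\<^sub>Q quat_j) *\<^sub>Q quat_j = - (W x *\<^sub>C c)"
    using intertwining_cisometry_j[OF T T' \<Omega> W(1,3)] by metis
  define d where "d = csqrt c"
  have d: "d * d = c" by (simp add: d_def flip: power2_eq_square)
  then have "(cmod d)\<^sup>2 = 1" using c(1) by (metis norm_mult power2_eq_square)
  then have dd: "cnj d * d = 1"
    using complex_norm_square[of d] by (simp add: mult.commute)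
  then have d_nz: "d \<noteq> 0" by auto
  have dd': "cnj d * (h * d) = h" for h
    using dd by (metis mult.assoc mult.commute mult.left_neutral)
  note D = cisometryD[OF W(1)]
  define U where "U x = W x *\<^sub>C d" for x
  have "cisometry U"
    unfolding cisometry_def
    by (simp add: U_def D(1-3) cscale_add_left cscale_cscale hinner_cscale_left hinner_cscale_right
        mult.commute[of d] dd')
  moreover have "surj U"
  proof (rule surjI)
    show "U (inv W (y *\<^sub>C inverse d)) = y" for y
      using d_nz by (simp add: U_def surj_f_inv_f[OF W(2)] cscale_cscale)
  qed
  moreover have "U (x *\<^sub>Q quat_j) = U x *\<^sub>Q quat_j" for x
  proof -
    have "W (x *\<^sub>Q quat_j) *\<^sub>Q quat_j *\<^sub>Q quat_j = - (W x *\<^sub>C c *\<^sub>Q quat_j)"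
      by (simp add: c(2))
    \<comment> \<open>Right multiplication by \<open>j\<close> cancels up to sign and conjugates \<open>c = d * d\<close>.\<close>
    then have "W (x *\<^sub>Q quat_j) = W x *\<^sub>Q quat_j *\<^sub>C (cnj d * cnj d)"
      by (simp add: scaleQ_j_j cscale_j flip: d)
    then show ?thesis by (simp add: U_def cscale_cscale cscale_j mult.assoc dd)
  qed
  ultimately have "qunitary U" by (rule qunitary_if_cisometry)
  moreover have "U \<circ> T = T' \<circ> U"
    by (simp add: fun_eq_iff U_def W(3) qoperatorsD(3)[OF B1sD(1)[OF T']])
  ultimately show ?thesis unfolding qunitarily_equivalent_def by blast
qed

section \<open>Transport to the space of columns\<close>

lemma bounded_complex_linear_on_complex_operator:
  assumes "orthonormal_basis N e" and T: "T \<in> qoperators"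
  shows "bounded_complex_linear_on (complex_space N e) (complex_operator N e T)"
proof -
  interpret T: bounded_linear T using T by (rule qoperatorsD)
  note [simp] = complex_operator_column[OF assms] cnorm_complex_column[OF assms(1)]
    qoperatorsD(3)[OF T]
  obtain C where "norm (T x) \<le> norm x * C" for x using T.bounded by blast
  then show ?thesis
    unfolding bounded_complex_linear_on_def complex_space_def
    by (auto simp: T.add mult.commute simp flip: complex_column_add complex_column_cscale
        intro!: exI[of _ C])
qed

theorem theorem5p7:
  fixes \<Omega> :: "quat set"
    and T T' :: "'a::separable_quat_hilbert \<Rightarrow> 'a"
    and N :: "nat set" and e :: "nat \<Rightarrow> 'a"
  assumes "orthonormal_basis N e"
    and "axially_symmetric \<Omega>" and "connected \<Omega>" and "open \<Omega>" and "\<Omega> \<inter> \<real> = {}"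
    and "T \<in> B1s \<Omega>" and "T' \<in> B1s \<Omega>"
  shows "qunitarily_equivalent T T' \<longleftrightarrow>
    cunitarily_equivalent_on (complex_space N e) (complex_operator N e T) (complex_operator N e T')"
proof
  note onb = \<open>orthonormal_basis N e\<close>
  note Top = B1sD(1)[OF \<open>T \<in> B1s \<Omega>\<close>] and T'op = B1sD(1)[OF \<open>T' \<in> B1s \<Omega>\<close>]
  note column = complex_operator_column[OF onb]
  note bounded = bounded_complex_linear_on_complex_operator[OF onb, unfolded complex_space_def]
  let ?K = "complex_space N e" and ?\<phi> = "complex_column N e"
  {
    assume "qunitarily_equivalent T T'"
    then obtain U V where U: "U \<in> qoperators" "V \<in> qoperators"
        "\<And>x y. qinner (U x) y = qinner x (V y)" "\<And>x. V (U x) = x" "\<And>x. U (V x) = x"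
        "\<And>x. U (T x) = T' (U x)"
      unfolding qunitarily_equivalent_def qunitary_def is_qadjoint_def by (auto simp: fun_eq_iff)
    \<comment> \<open>The complex operators of \<open>U\<close> and of its adjoint are mutually inverse adjoints.\<close>
    have "is_cadjoint_on ?K (complex_operator N e U) (complex_operator N e V)"
      unfolding is_cadjoint_on_def
      by (auto simp: bounded[OF U(2)] complex_space_def
          column U(1,2) cinner_complex_column[OF onb] hinner_def U(3))
    then have "cunitary_on ?K (complex_operator N e U)"
      unfolding cunitary_on_def
      by (auto simp: bounded[OF U(1)] complex_space_def
          column U(1,2,4,5) intro!: exI[of _ "complex_operator N e V"])
    then show "cunitarily_equivalent_on ?K (complex_operator N e T) (complex_operator N e T')"
      unfolding cunitarily_equivalent_on_def
      by (intro exI[of _ "complex_operator N e U"])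
        (auto simp: complex_space_def column U(1,6) Top T'op)
  }
  {
    assume "cunitarily_equivalent_on ?K (complex_operator N e T) (complex_operator N e T')"
    then obtain W' where "cunitary_on ?K W'"
      and intertwine: "\<forall>x\<in>?K. W' (complex_operator N e T x) = complex_operator N e T' (W' x)"
      unfolding cunitarily_equivalent_on_def by blast
    then obtain V' where bd: "bounded_complex_linear_on ?K W'" "is_cadjoint_on ?K W' V'"
        and inverse: "\<forall>x\<in>?K. V' (W' x) = x \<and> W' (V' x) = x"
      unfolding cunitary_on_def by blast
    have \<phi>K: "?\<phi> x \<in> ?K" for x by (simp add: complex_space_def)
    have K: "W' ` ?K \<subseteq> ?K" "V' ` ?K \<subseteq> ?K"
      using bd by (simp_all add: is_cadjoint_on_def bounded_complex_linear_on_def)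
    have "W' (?\<phi> x) \<in> ?K" "V' (?\<phi> x) \<in> ?K" for x
      using K \<phi>K by blast+
    then have exW: "\<forall>x. \<exists>y. W' (?\<phi> x) = ?\<phi> y" and exV: "\<forall>x. \<exists>y. V' (?\<phi> x) = ?\<phi> y"
      unfolding complex_space_def image_iff by simp_all
    \<comment> \<open>The columns are in bijection with the vectors, so \<open>W'\<close> and \<open>V'\<close> are maps on vectors.\<close>
    from choice[OF exW] obtain W where W': "W' (?\<phi> x) = ?\<phi> (W x)" for x
      by (elim exE) simp
    from choice[OF exV] obtain V where V': "V' (?\<phi> x) = ?\<phi> (V x)" for x
      by (elim exE) simp
    note W = W'[symmetric] and V = V'[symmetric]
    note inj = complex_column_inject[OF onb, THEN iffD1]
    have "cisometry W"
      unfolding cisometry_def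
    proof (intro conjI allI)
      show "W (x + y) = W x + W y" for x y
        using bd(1) \<phi>K by (intro inj) (simp add: W complex_column_add bounded_complex_linear_on_def)
      show "W (x *\<^sub>C c) = W x *\<^sub>C c" for x c
        using bd(1) \<phi>K
        by (intro inj) (simp add: W complex_column_cscale bounded_complex_linear_on_def)
      show "hinner (W x) (W y) = hinner x y" for x y
      proof -
        have "cinner (W' (?\<phi> x)) (?\<phi> (W y)) = cinner (?\<phi> x) (V' (?\<phi> (W y)))"
          using bd(2) \<phi>K unfolding is_cadjoint_on_def by blast
        then show ?thesis
          by (simp add: W inverse \<phi>K cinner_complex_column[OF onb, symmetric])
      qed
    qed
    moreover have "surj W"
      by (rule surjI[of W V], rule inj) (simp add: W V inverse \<phi>K)
    moreover have "W (T x) = T' (W x)" for x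
      using bspec[OF intertwine \<phi>K[of x]] by (intro inj) (simp add: column Top T'op W')
    ultimately show "qunitarily_equivalent T T'"
      using qunitarily_equivalent_if_cisometry assms by metis
  }
qed

end
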